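(* Let $M$ be a Riemannian manifold, $\mathcal{F}$ a foliation on $M$, $p>1$, and let $f_0$ be an extremal function for the $p$-modulus of $\mathcal{F}$. Then: (1) $\int_L f_0\,d\mu_L=1$ for almost every leaf $L\in\mathcal{F}$; (2) $f_0$ is positive $\mu_M$-almost everywhere on $M$.
   Context: $\mu_M$ and $\mu_L$ denote the Lebesgue (Riemannian volume) measures on $M$ and on a leaf $L\in\mathcal{F}$. A property holds for almost every $L\in\mathcal{F}$ if the union of the leaves for which it fails has $\mu_M$-measure zero. $\mathrm{adm}_p(\mathcal{F})$ is the family of all nonnegative $f\in L^p(M)$ such that $\int_L f\,d\mu_L\geq 1$ for almost every $L\in\mathcal{F}$; $\mathrm{mod}_p(\mathcal{F})=\inf_{f\in\mathrm{adm}_p(\mathcal{F})}\|f\|_p$ if $\mathrm{adm}_p(\mathcal{F})\neq\emptyset$ and $\mathrm{mod}_p(\mathcal{F})=\infty$ otherwise. A function $f_0\in\mathrm{adm}_p(\mathcal{F})$ is extremal for the $p$-modulus of $\mathcal{F}$ if $\mathrm{mod}_p(\mathcal{F})=\|f_0\|_p$. *)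

theory Defs
  imports "HOL-Analysis.Analysis"
begin

text \<open>
  The manifold is a whole type \<open>'a\<close>, Hausdorff and second countable by type class, of
  dimension \<open>CARD('n)\<close>. A chart is a pair of a domain and a coordinate map; values of the
  coordinate map outside the domain are irrelevant.
\<close>

type_synonym ('a, 'n) chart = "'a set \<times> ('a \<Rightarrow> real ^ 'n)"

abbreviation cdom :: "('a, 'n) chart \<Rightarrow> 'a set" where "cdom \<equiv> fst"
abbreviation cmap :: "('a, 'n) chart \<Rightarrow> 'a \<Rightarrow> real ^ 'n" where "cmap \<equiv> snd"

text \<open>Intended for open \<open>S\<close>; clause \<open>Suc k\<close> asks for all directional derivatives
  to be of class \<open>C\<^sup>k\<close>.\<close>

primrec Ck_on :: "nat \<Rightarrow> 'a::euclidean_space set \<Rightarrow> ('a \<Rightarrow> 'b::real_normed_vector) \<Rightarrow> bool" where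
  "Ck_on 0 S f \<longleftrightarrow> continuous_on S f"
| "Ck_on (Suc k) S f \<longleftrightarrow> (\<forall>x\<in>S. f differentiable (at x)) \<and>
     (\<forall>v. Ck_on k S (\<lambda>x. frechet_derivative f (at x) v))"

definition smooth_on :: "'a::euclidean_space set \<Rightarrow> ('a \<Rightarrow> 'b::real_normed_vector) \<Rightarrow> bool" where
  "smooth_on S f \<longleftrightarrow> (\<forall>k. Ck_on k S f)"

definition is_chart :: "('a::topological_space, 'n::finite) chart \<Rightarrow> bool" where
  "is_chart c \<longleftrightarrow> open (cdom c) \<and> open (cmap c ` cdom c) \<and>
     (\<exists>\<psi>. homeomorphism (cdom c) (cmap c ` cdom c) (cmap c) \<psi>)"

definition transition ::
    "('a, 'n) chart \<Rightarrow> ('a, 'n) chart \<Rightarrow> real ^ 'n \<Rightarrow> real ^ 'n" where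
  "transition c d = cmap d \<circ> inv_into (cdom c) (cmap c)"

definition smoothly_compatible ::
    "('a, 'n::finite) chart \<Rightarrow> ('a, 'n) chart \<Rightarrow> bool" where
  "smoothly_compatible c d \<longleftrightarrow>
     smooth_on (cmap c ` (cdom c \<inter> cdom d)) (transition c d) \<and>
     smooth_on (cmap d ` (cdom c \<inter> cdom d)) (transition d c)"

text \<open>A smooth structure is a maximal smooth atlas.\<close>

definition smooth_structure :: "('a::topological_space, 'n::finite) chart set \<Rightarrow> bool" where
  "smooth_structure A \<longleftrightarrow>
     (\<forall>c\<in>A. is_chart c) \<and> (\<Union>c\<in>A. cdom c) = UNIV \<and>
     (\<forall>c\<in>A. \<forall>d\<in>A. smoothly_compatible c d) \<and>
     (\<forall>c. is_chart c \<and> (\<forall>d\<in>A. smoothly_compatible c d) \<longrightarrow> c \<in> A)"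

text \<open>
  A metric is given in coordinates: \<open>g c x\<close> is the Gram matrix of the coordinate frame of the
  chart \<open>c\<close> at the point with coordinates \<open>x\<close>. The last clause is the transformation law
  of a covariant 2-tensor, with \<open>J\<close> the Jacobian matrix of the change of coordinates.
\<close>

type_synonym ('a, 'n) metric = "('a, 'n) chart \<Rightarrow> real ^ 'n \<Rightarrow> real ^ 'n ^ 'n"

definition riemannian_metric ::
    "('a::topological_space, 'n::finite) chart set \<Rightarrow> ('a, 'n) metric \<Rightarrow> bool" where
  "riemannian_metric A g \<longleftrightarrow>
     (\<forall>c\<in>A. smooth_on (cmap c ` cdom c) (g c) \<and>
        (\<forall>x \<in> cmap c ` cdom c. transpose (g c x) = g c x \<and>
           (\<forall>v. v \<noteq> 0 \<longrightarrow> v \<bullet> (g c x *v v) > 0))) \<and>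
     (\<forall>c\<in>A. \<forall>d\<in>A. \<forall>x \<in> cmap c ` (cdom c \<inter> cdom d).
        (let J = matrix (frechet_derivative (transition c d) (at x))
         in g c x = transpose J ** g d (transition c d x) ** J))"

definition riemannian_manifold ::
    "('a::{t2_space, second_countable_topology}, 'n::finite) chart set \<Rightarrow> ('a, 'n) metric \<Rightarrow> bool"
  where "riemannian_manifold A g \<longleftrightarrow> smooth_structure A \<and> riemannian_metric A g"

text \<open>
  \<open>K\<close> is the set of indices of the leafwise coordinates, so leaves have dimension
  \<open>card K\<close> and codimension \<open>card (- K)\<close>; the extreme cases \<open>K = {}\<close> (leaves are points)
  and \<open>K = UNIV\<close> (leaves are the connected components) are included.
\<close>

definition plaques_of :: "'n set \<Rightarrow> ('a, 'n::finite) chart \<Rightarrow> 'a set set" where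
  "plaques_of K c = {P. P \<noteq> {} \<and> (\<exists>t. P = {x \<in> cdom c. \<forall>i. i \<notin> K \<longrightarrow> cmap c x $ i = t i})}"

text \<open>
  A foliation is given by a foliated atlas: charts of the smooth structure onto products of open
  intervals (the open sets satisfying \<^const>\<open>is_interval\<close>) that are coherent, i.e. any two plaques
  intersect in a set that is open in both of them.
\<close>

definition foliated_atlas ::
    "('a::topological_space, 'n::finite) chart set \<Rightarrow> 'n set \<Rightarrow> ('a, 'n) chart set \<Rightarrow> bool" where
  "foliated_atlas A K B \<longleftrightarrow> B \<subseteq> A \<and> (\<Union>c\<in>B. cdom c) = UNIV \<and>
     (\<forall>c\<in>B. is_interval (cmap c ` cdom c)) \<and>
     (\<forall>c\<in>B. \<forall>d\<in>B. \<forall>P \<in> plaques_of K c. \<forall>Q \<in> plaques_of K d.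
        openin (top_of_set P) (P \<inter> Q) \<and> openin (top_of_set Q) (P \<inter> Q))"

text \<open>Two points lie on the same leaf iff they are joined by a finite chain of plaques.\<close>

definition plaque_rel :: "'n set \<Rightarrow> ('a, 'n::finite) chart set \<Rightarrow> ('a \<times> 'a) set" where
  "plaque_rel K B = {(x, y). \<exists>c\<in>B. \<exists>P \<in> plaques_of K c. x \<in> P \<and> y \<in> P}"

definition leaves :: "'n set \<Rightarrow> ('a, 'n::finite) chart set \<Rightarrow> 'a set set" where
  "leaves K B = UNIV // (plaque_rel K B)\<^sup>*"

text \<open>
  The measures are assembled from a countable family of charts covering the manifold (one exists
  by second countability), cut down to disjoint pieces. By the change of variables formula and
  the transformation law of the metric, the result does not depend on the chosen family.
\<close>

definition chart_seq :: "('a, 'n) chart set \<Rightarrow> nat \<Rightarrow> ('a, 'n) chart" where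
  "chart_seq C = (SOME s. range s \<subseteq> C \<and> (\<Union>i. cdom (s i)) = UNIV)"

definition piece :: "(nat \<Rightarrow> ('a, 'n) chart) \<Rightarrow> nat \<Rightarrow> 'a set" where
  "piece s i = cdom (s i) - (\<Union>j<i. cdom (s j))"

definition riem_measure ::
    "('a::topological_space, 'n::finite) chart set \<Rightarrow> ('a, 'n) metric \<Rightarrow> 'a measure" where
  "riem_measure A g =
     (let s = chart_seq A in
      completion (measure_of UNIV (sets borel)
        (\<lambda>E. \<Sum>i. \<integral>\<^sup>+ x. ennreal (sqrt (det (g (s i) x))) *
               indicator (cmap (s i) ` (E \<inter> piece s i)) x \<partial>lborel)))"

text \<open>
  The determinant of the principal submatrix with indices in \<open>K\<close>: rows and columns outside
  \<open>K\<close> are replaced by those of the identity. For \<open>G = g c x\<close> it is the Gram determinant of the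
  metric induced on the plaque through \<open>x\<close>.
\<close>

definition minor_det :: "'n set \<Rightarrow> real ^ 'n ^ 'n \<Rightarrow> real" where
  "minor_det K G =
     det (\<chi> i j. if i \<in> K \<and> j \<in> K then G $ i $ j else if i = j then 1 else 0)"

definition splice :: "'n set \<Rightarrow> ('n \<Rightarrow> real) \<Rightarrow> real ^ 'n \<Rightarrow> real ^ 'n" where
  "splice K y t = (\<chi> i. if i \<in> K then y i else t $ i)"

text \<open>
  The Riemannian measure of a leaf \<open>L\<close> with the induced metric. The outer integral sums over the
  transverse positions \<open>t\<close>, i.e. over the plaques of \<open>s i\<close>; only plaques contained in \<open>L\<close>
  contribute. The inner one is over the \<open>card K\<close>-dimensional Lebesgue measure. Since \<open>L\<close> is a
  countable union of plaques, the Borel sets of \<open>L\<close> in its leaf topology are the traces on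
  \<open>L\<close> of the Borel sets of the manifold.
\<close>

definition leaf_measure ::
    "'n set \<Rightarrow> ('a::topological_space, 'n::finite) chart set \<Rightarrow> ('a, 'n) metric \<Rightarrow> 'a set \<Rightarrow> 'a measure"
  where
  "leaf_measure K B g L =
     (let s = chart_seq B in
      completion (measure_of L (sets (restrict_space borel L))
        (\<lambda>E. \<Sum>i. \<integral>\<^sup>+ t. (\<integral>\<^sup>+ y. ennreal (sqrt (minor_det K (g (s i) (splice K y t)))) *
                 indicator (cmap (s i) ` (E \<inter> piece s i)) (splice K y t)
               \<partial>(\<Pi>\<^sub>M i\<in>K. lborel)) \<partial>count_space {t. \<forall>i\<in>K. t $ i = 0})))"

definition almost_every_leaf :: "'a measure \<Rightarrow> 'a set set \<Rightarrow> ('a set \<Rightarrow> bool) \<Rightarrow> bool" where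
  "almost_every_leaf \<mu> \<F> P \<longleftrightarrow> \<Union>{L \<in> \<F>. \<not> P L} \<in> null_sets \<mu>"

definition Lp_space :: "'a measure \<Rightarrow> real \<Rightarrow> ('a \<Rightarrow> real) set" where
  "Lp_space \<mu> p = {f \<in> borel_measurable \<mu>. integrable \<mu> (\<lambda>x. \<bar>f x\<bar> powr p)}"

definition Lp_norm :: "'a measure \<Rightarrow> real \<Rightarrow> ('a \<Rightarrow> real) \<Rightarrow> real" where
  "Lp_norm \<mu> p f = (\<integral>x. \<bar>f x\<bar> powr p \<partial>\<mu>) powr (1 / p)"

text \<open>In the following, \<open>\<mu>\<close> is the measure of the manifold, \<open>\<F>\<close> the set of leaves, and
  \<open>\<nu> L\<close> the measure of the leaf \<open>L\<close>.\<close>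

definition adm ::
    "'a measure \<Rightarrow> 'a set set \<Rightarrow> ('a set \<Rightarrow> 'a measure) \<Rightarrow> real \<Rightarrow> ('a \<Rightarrow> real) set" where
  "adm \<mu> \<F> \<nu> p = {f \<in> Lp_space \<mu> p. (\<forall>x. 0 \<le> f x) \<and>
     almost_every_leaf \<mu> \<F> (\<lambda>L. (\<integral>\<^sup>+ x. ennreal (f x) \<partial>\<nu> L) \<ge> 1)}"

definition modulus ::
    "'a measure \<Rightarrow> 'a set set \<Rightarrow> ('a set \<Rightarrow> 'a measure) \<Rightarrow> real \<Rightarrow> ennreal" where
  "modulus \<mu> \<F> \<nu> p =
     (if adm \<mu> \<F> \<nu> p \<noteq> {} then INF f \<in> adm \<mu> \<F> \<nu> p. ennreal (Lp_norm \<mu> p f) else \<infinity>)"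

definition extremal ::
    "'a measure \<Rightarrow> 'a set set \<Rightarrow> ('a set \<Rightarrow> 'a measure) \<Rightarrow> real \<Rightarrow> ('a \<Rightarrow> real) \<Rightarrow> bool" where
  "extremal \<mu> \<F> \<nu> p f \<longleftrightarrow>
     f \<in> adm \<mu> \<F> \<nu> p \<and> modulus \<mu> \<F> \<nu> p = ennreal (Lp_norm \<mu> p f)"

end

theory Submission
  imports Defs
begin

text \<open>
  Replacing \<open>f\<^sub>0\<close> on each leaf \<open>L\<close> by \<open>f\<^sub>0 / max 1 (min 2 (\<integral>\<^sub>L f\<^sub>0))\<close> keeps it admissible, so by
  minimality \<open>f\<^sub>0\<close> vanishes almost everywhere on the leaves with \<open>\<integral>\<^sub>L f\<^sub>0 > 1\<close>; hence almost all of
  these have integral 0, and their union is null. If \<open>f\<^sub>0\<close> vanished on a set \<open>Z\<close> of positive finite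
  measure, put \<open>\<phi> = min 1 (\<mu>\<^sub>L Z)\<close>: the functions \<open>(1 - \<epsilon> \<phi>) f\<^sub>0 + \<epsilon> 1\<^sub>Z\<close> are admissible, and comparing
  \<open>p\<close>-norms gives \<open>\<epsilon> \<integral> \<phi> f\<^sub>0\<^sup>p \<le> \<epsilon>\<^sup>p \<mu> Z\<close>. As \<open>p > 1\<close>, letting \<open>\<epsilon>\<close> tend to 0 shows that \<open>f\<^sub>0\<close> vanishes
  on almost every leaf that charges \<open>Z\<close>, which is impossible unless these leaves form a null set,
  and then \<open>Z\<close> is null.

  Two facts about the foliation enter: the leaf measures of a Borel set form a Borel function on
  the manifold, and a Borel set is null iff it is null in almost every leaf. The first is obtained
  by enumerating the plaques of the leaf through a point with countably many Borel maps, the second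
  from Fubini's theorem in foliated charts.
\<close>

section \<open>Minimizers for abstract leaf measures\<close>

text \<open>Leaves are given by the map \<open>leaf\<close> on points, so that a quantity attached
  to leaves becomes a function on \<open>M\<close> and almost every leaf becomes almost every point.
  \<open>M\<close> stands for the measure on Borel sets, before completion: a set of the completed
  sigma-algebra can have a nonmeasurable trace on some leaf.\<close>

locale leaf_system =
  fixes M :: "'a measure" and leaf :: "'a \<Rightarrow> 'a set" and \<nu> :: "'a set \<Rightarrow> 'a measure"
  assumes sigma_finite: "sigma_finite_measure M"
    and space_M [simp]: "space M = UNIV"
    and leaf_self: "x \<in> leaf x"
    and leaf_eq: "y \<in> leaf x \<Longrightarrow> leaf y = leaf x"
    and space_leaf [simp]: "space (\<nu> (leaf x)) = leaf x"
    and sets_leaf: "E \<in> sets M \<Longrightarrow> E \<inter> leaf x \<in> sets (\<nu> (leaf x))"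
    and emeasure_leaf_measurable:
      "E \<in> sets M \<Longrightarrow> (\<lambda>x. emeasure (\<nu> (leaf x)) (E \<inter> leaf x)) \<in> borel_measurable M"
    and null_iff: "E \<in> sets M \<Longrightarrow>
      E \<in> null_sets M \<longleftrightarrow> {x. emeasure (\<nu> (leaf x)) (E \<inter> leaf x) \<noteq> 0} \<in> null_sets M"
begin

section \<open>Leaf integrals and null sets\<close>

definition leaf_integral :: "('a \<Rightarrow> ennreal) \<Rightarrow> 'a \<Rightarrow> ennreal" where
  "leaf_integral f x = (\<integral>\<^sup>+ y. f y \<partial>\<nu> (leaf x))"

lemma measurable_leaf:
  assumes "f \<in> measurable M N" shows "f \<in> measurable (\<nu> (leaf x)) N"
proof (rule measurableI)
  fix A assume "A \<in> sets N"
  then have "f -` A \<in> sets M" using measurable_sets[OF assms] by simp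
  then show "f -` A \<inter> space (\<nu> (leaf x)) \<in> sets (\<nu> (leaf x))" using sets_leaf by simp
qed (use measurable_space[OF assms] in auto)

lemma leaf_integral_indicator:
  assumes "E \<in> sets M"
  shows "leaf_integral (indicator E) x = emeasure (\<nu> (leaf x)) (E \<inter> leaf x)"
proof -
  have "leaf_integral (indicator E) x = (\<integral>\<^sup>+ y. indicator (E \<inter> leaf x) y \<partial>\<nu> (leaf x))"
    unfolding leaf_integral_def by (intro nn_integral_cong) (simp add: indicator_def)
  then show ?thesis using sets_leaf[OF assms] by simp
qed

lemma leaf_integral_measurable:
  assumes "f \<in> borel_measurable M" shows "leaf_integral f \<in> borel_measurable M"
  using assms
proof (induction rule: borel_measurable_induct)
  case (cong f g)
  then have "f = g" by auto
  then show ?case using cong by simp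
next
  case (set E)
  then show ?case using emeasure_leaf_measurable[of E]
    by (simp add: leaf_integral_indicator cong: measurable_cong)
next
  case (mult u c)
  have "leaf_integral (\<lambda>x. c * u x) = (\<lambda>x. c * leaf_integral u x)"
    by (rule ext, unfold leaf_integral_def, rule nn_integral_cmult[OF measurable_leaf[OF mult(2)]])
  then show ?case using mult by simp
next
  case (add u v)
  have "leaf_integral (\<lambda>x. v x + u x) = (\<lambda>x. leaf_integral v x + leaf_integral u x)"
    by (rule ext, unfold leaf_integral_def,
        rule nn_integral_add[OF measurable_leaf measurable_leaf]) (use add in auto)
  then show ?case using add by simp
next
  case (seq U)
  have "leaf_integral (SUP i. U i) = (\<lambda>x. SUP i. leaf_integral (U i) x)"
    unfolding leaf_integral_def
    using nn_integral_monotone_convergence_SUP[OF seq(3) measurable_leaf[OF seq(1)]]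
    by (auto simp: SUP_apply[abs_def] fun_eq_iff)
  then show ?case using seq borel_measurable_SUP[of UNIV "\<lambda>i. leaf_integral (U i)" M] by (simp only:) simp
qed

text \<open>The union of the exceptional leaves is exactly the set of points whose leaf is
  exceptional. Null for the completion means covered by a null set of \<open>M\<close>, which is
  also what \<open>AE\<close> asks for.\<close>

lemma almost_every_leaf_iff_AE:
  "almost_every_leaf (completion M) (range leaf) P \<longleftrightarrow> (AE x in M. P (leaf x))"
proof -
  have "\<Union>{L \<in> range leaf. \<not> P L} = {x. \<not> P (leaf x)}"
    using leaf_self leaf_eq by fastforce
  then show ?thesis
    by (simp add: almost_every_leaf_def null_sets_completion_iff2 eventually_ae_filter Bex_def)
qed

text \<open>The support of \<open>f\<close> is null, so by \<open>null_iff\<close> it is null in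
  almost every leaf.\<close>

lemma leaf_integral_eq_0:
  assumes [measurable]: "f \<in> borel_measurable M" and "AE x in M. f x = 0"
  shows "AE x in M. leaf_integral f x = 0"
proof -
  define N where "N = {x. f x \<noteq> 0}"
  have N: "N \<in> sets M"
  proof -
    have "{x \<in> space M. f x \<noteq> 0} \<in> sets M" by measurable
    then show ?thesis by (simp add: N_def)
  qed
  then have "N \<in> null_sets M"
    using assms(2) by (subst (asm) AE_iff_null) (auto simp: N_def)
  then have "AE x in M. emeasure (\<nu> (leaf x)) (N \<inter> leaf x) = 0"
    using null_iff[OF N] AE_not_in by fastforce
  then show ?thesis
  proof eventually_elim
    case (elim x)
    have "AE y in \<nu> (leaf x). f y = 0"
      using elim sets_leaf[OF N, of x]
      by (intro AE_I[where N="N \<inter> leaf x"]) (auto simp: N_def)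
    then show ?case
      unfolding leaf_integral_def by (simp add: nn_integral_0_iff_AE measurable_leaf)
  qed
qed

text \<open>Applying \<open>null_iff\<close> to a null set \<open>N\<close> of \<open>M\<close>
  around the exceptional points covers functions that are measurable for the completion only; this
  is how an extremal function is exchanged for a Borel one.\<close>

lemma leaf_integral_cong_AE:
  assumes "AE x in M. f x = g x"
  shows "AE x in M. leaf_integral f x = leaf_integral g x"
proof -
  obtain N where N: "N \<in> null_sets M" "{x. f x \<noteq> g x} \<subseteq> N"
    using assms by (auto simp: eventually_ae_filter)
  have "AE x in M. emeasure (\<nu> (leaf x)) (N \<inter> leaf x) = 0"
    using null_iff[of N] N(1) AE_not_in by fastforce
  then show ?thesis
  proof eventually_elim
    case (elim x)
    have "AE y in \<nu> (leaf x). f y = g y"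
      using elim sets_leaf[of N x] N
      by (intro AE_I[where N="N \<inter> leaf x"]) auto
    then show ?case
      unfolding leaf_integral_def by (rule nn_integral_cong_AE)
  qed
qed

lemma leaf_integral_saturated_mult:
  assumes "f \<in> borel_measurable M" and "\<And>y. y \<in> leaf x \<Longrightarrow> c y = c x"
  shows "leaf_integral (\<lambda>y. c y * f y) x = c x * leaf_integral f x"
proof -
  have "leaf_integral (\<lambda>y. c y * f y) x = (\<integral>\<^sup>+ y. c x * f y \<partial>\<nu> (leaf x))"
    unfolding leaf_integral_def by (intro nn_integral_cong) (simp add: assms(2))
  then show ?thesis
    using assms(1) by (simp add: leaf_integral_def nn_integral_cmult measurable_leaf)
qed

lemma leaf_integral_leaf: "y \<in> leaf x \<Longrightarrow> leaf_integral f y = leaf_integral f x"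
  by (simp add: leaf_integral_def leaf_eq)

text \<open>The product of \<open>f\<close> with the indicator of \<open>G\<close> vanishes almost
  everywhere, so its integral over almost every leaf is 0. But over a leaf inside the saturated set
  \<open>G\<close> it has the same integral as \<open>f\<close>, and that is at least 1 for almost
  every leaf.\<close>

lemma saturated_AE_notin:
  assumes [measurable]: "f \<in> borel_measurable M"
    and adm: "AE x in M. leaf_integral f x \<ge> 1"
    and sat: "\<And>x y. y \<in> leaf x \<Longrightarrow> y \<in> G \<longleftrightarrow> x \<in> G"
    and [measurable]: "G \<in> sets M"
    and zero: "AE x in M. x \<in> G \<longrightarrow> f x = 0"
  shows "AE x in M. x \<notin> G"
proof -
  have "AE x in M. indicator G x * f x = 0"
    using zero by eventually_elim (auto simp: indicator_def)
  then have "AE x in M. leaf_integral (\<lambda>x. indicator G x * f x) x = 0"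
    by (intro leaf_integral_eq_0) measurable
  then show ?thesis
    using adm
  proof eventually_elim
    case (elim x)
    have "leaf_integral (\<lambda>x. indicator G x * f x) x = indicator G x * leaf_integral f x"
      using sat by (intro leaf_integral_saturated_mult) (auto simp: indicator_def)
    then show ?case using elim by (auto simp: indicator_def split: if_splits)
  qed
qed

section \<open>Variational properties of minimizers\<close>

definition admissible :: "real \<Rightarrow> ('a \<Rightarrow> real) \<Rightarrow> bool" where
  "admissible p h \<longleftrightarrow> h \<in> borel_measurable M \<and> (\<forall>x. 0 \<le> h x) \<and>
     integrable M (\<lambda>x. h x powr p) \<and> (AE x in M. 1 \<le> leaf_integral (\<lambda>y. ennreal (h y)) x)"

text \<open>Integrals of p-th powers are compared instead of norms; taking the root is strictly
  increasing, so for positive \<open>p\<close> this is the same minimality.\<close>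

definition minimizer :: "real \<Rightarrow> ('a \<Rightarrow> real) \<Rightarrow> bool" where
  "minimizer p f \<longleftrightarrow> admissible p f \<and>
     (\<forall>h. admissible p h \<longrightarrow> (\<integral>x. f x powr p \<partial>M) \<le> (\<integral>x. h x powr p \<partial>M))"

lemma minimizer_leaf_integral:
  assumes p: "p > 0" and f: "minimizer p f"
  shows "AE x in M. leaf_integral (\<lambda>y. ennreal (f y)) x = 1"
proof -
  have [measurable]: "f \<in> borel_measurable M" and f0: "\<And>x. 0 \<le> f x"
    and int: "integrable M (\<lambda>x. f x powr p)"
    and adm: "AE x in M. 1 \<le> leaf_integral (\<lambda>y. ennreal (f y)) x"
    and min: "\<And>h. admissible p h \<Longrightarrow> (\<integral>x. f x powr p \<partial>M) \<le> (\<integral>x. h x powr p \<partial>M)"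
    using f by (auto simp: minimizer_def admissible_def)
  define F where "F = leaf_integral (\<lambda>y. ennreal (f y))"
  have [measurable]: "F \<in> borel_measurable M"
    unfolding F_def by (intro leaf_integral_measurable) measurable
  \<comment> \<open>The lower bound 1 gives \<open>c x \<le> 1\<close>. The cap 2 keeps the divisor
    finite where \<open>F x\<close> is infinite: \<open>enn2real\<close> sends infinity to 0, and
    \<open>c\<close> would vanish there. Leaves with \<open>F x \<ge> 2\<close> still keep integral
    at least 1 after halving.\<close>
  define c where "c x = 1 / enn2real (max 1 (min 2 (F x)))" for x
  have [measurable]: "c \<in> borel_measurable M" unfolding c_def by measurable
  have r1: "1 \<le> enn2real (max 1 (min 2 (F x)))" for x
  proof -
    have "max 1 (min 2 (F x)) < top" by (simp add: max_less_iff_conj min_less_iff_disj)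
    from enn2real_mono[OF _ this, of 1] show ?thesis by simp
  qed
  then have c: "0 \<le> c x" "c x \<le> 1" for x
    by (auto simp: c_def divide_simps) (use r1[of x] in linarith)+
  have Fc: "1 \<le> ennreal (c x) * F x" if "1 \<le> F x" for x
  proof (cases "F x \<ge> 2")
    case True
    then have "c x = 1/2" by (simp add: c_def min_def max_def)
    have "1 = ennreal (1/2) * 2" by (metis ennreal_1 ennreal_mult'' ennreal_numeral nonzero_divide_eq_eq zero_le_numeral zero_neq_numeral)
    also have "\<dots> \<le> ennreal (c x) * F x"
      unfolding \<open>c x = 1/2\<close> using True by (intro mult_mono) auto
    finally show ?thesis .
  next
    case False
    then obtain r where r: "F x = ennreal r" "0 \<le> r" by (cases "F x") (auto simp: top_unique)
    then have "1 \<le> r" using that by (metis ennreal_1 ennreal_le_iff)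
    have "c x = 1 / r" using False that r by (simp add: c_def min_def max_def)
    then have "ennreal (c x) * F x = 1"
      using r \<open>1 \<le> r\<close> by (simp flip: ennreal_mult)
    then show ?thesis by simp
  qed
  have "c y = c x" if "y \<in> leaf x" for x y
    using leaf_integral_leaf[OF that] by (simp add: c_def F_def)
  then have "leaf_integral (\<lambda>y. ennreal (c y * f y)) x = ennreal (c x) * F x" for x
    unfolding F_def using c(1) f0
    by (subst leaf_integral_saturated_mult[symmetric]) (auto simp: ennreal_mult)
  moreover have pw: "(c x * f x) powr p \<le> f x powr p" for x
    using c f0 p by (intro powr_mono2) (auto simp: mult_left_le_one_le)
  moreover have int': "integrable M (\<lambda>x. (c x * f x) powr p)"
    using pw by (intro Bochner_Integration.integrable_bound[OF int]) auto
  ultimately have "admissible p (\<lambda>x. c x * f x)"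
    using c f0 adm Fc by (auto simp: admissible_def F_def)
  \<comment> \<open>The new function lies below \<open>f\<close> pointwise, and minimality forbids a
    smaller integral, so the p-th powers agree almost everywhere.\<close>
  from min[OF this] have "(\<integral>x. f x powr p - (c x * f x) powr p \<partial>M) \<le> 0"
    using int int' by simp
  moreover have "0 \<le> (\<integral>x. f x powr p - (c x * f x) powr p \<partial>M)"
    using pw by (intro integral_nonneg_AE) auto
  ultimately have "AE x in M. f x powr p - (c x * f x) powr p = 0"
    using pw int int' by (subst integral_nonneg_eq_0_iff_AE[symmetric]) auto
  then have "AE x in M. x \<in> {x. F x > 1} \<longrightarrow> f x = 0"
  proof eventually_elim
    case (elim x)
    have "f x = 0" if "F x > 1"
    proof (rule ccontr)
      assume "f x \<noteq> 0"
      have "1 < enn2real (max 1 (min 2 (F x)))"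
      proof -
        have "1 < max 1 (min 2 (F x))" "max 1 (min 2 (F x)) < top"
          using that by (simp_all add: max_less_iff_conj min_less_iff_disj less_max_iff_disj)
        then show ?thesis
          by (cases "max 1 (min 2 (F x))") (simp_all add: ennreal_less_iff flip: ennreal_1)
      qed
      then have "c x < 1" by (simp add: c_def)
      then have "(c x * f x) powr p < f x powr p"
        using \<open>f x \<noteq> 0\<close> f0[of x] c[of x] p by (intro powr_less_mono2) auto
      then show False using elim by simp
    qed
    then show ?case by simp
  qed
  moreover have "{x. F x > 1} \<in> sets M"
  proof -
    have "{x \<in> space M. F x > 1} \<in> sets M" by measurable
    then show ?thesis by simp
  qed
  \<comment> \<open>\<open>F\<close> is constant on leaves, so the set where it exceeds 1 is
    saturated; there \<open>c x < 1\<close> has forced \<open>f\<close> to vanish.\<close>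
  ultimately have "AE x in M. x \<notin> {x. F x > 1}"
    using adm leaf_integral_leaf
    by (intro saturated_AE_notin[where f="\<lambda>x. ennreal (f x)"]) (auto simp: F_def)
  with adm show ?thesis
    by eventually_elim (auto simp: F_def)
qed

lemma minimizer_pos:
  assumes p: "p > 1" and f: "minimizer p f"
  shows "AE x in M. f x > 0"
proof -
  have [measurable]: "f \<in> borel_measurable M" and f0: "\<And>x. 0 \<le> f x"
    and int: "integrable M (\<lambda>x. f x powr p)"
    and adm: "AE x in M. 1 \<le> leaf_integral (\<lambda>y. ennreal (f y)) x"
    and min: "\<And>h. admissible p h \<Longrightarrow> (\<integral>x. f x powr p \<partial>M) \<le> (\<integral>x. h x powr p \<partial>M)"
    using f by (auto simp: minimizer_def admissible_def)
  \<comment> \<open>Finite measure makes the indicator of \<open>Z\<close> a legitimate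
    perturbation; sigma-finiteness later exhausts the zero set of \<open>f\<close> by such
    \<open>Z\<close>.\<close>
  have Z: "Z \<in> null_sets M" if [measurable]: "Z \<in> sets M" and fin: "emeasure M Z \<noteq> \<infinity>"
    and fZ: "\<And>x. x \<in> Z \<Longrightarrow> f x = 0" for Z
  proof -
    define \<psi> where "\<psi> = leaf_integral (indicator Z)"
    have [measurable]: "\<psi> \<in> borel_measurable M"
      unfolding \<psi>_def by (intro leaf_integral_measurable) measurable
    \<comment> \<open>Truncation at 1 keeps \<open>\<phi>\<close> finite on leaves where
      \<open>Z\<close> has infinite measure, and keeps \<open>1 - e * \<phi> x\<close> nonnegative
      for \<open>e \<le> 1\<close>.\<close>
    define \<phi> where "\<phi> x = enn2real (min 1 (\<psi> x))" for x
    have [measurable]: "\<phi> \<in> borel_measurable M" unfolding \<phi>_def by measurable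
    have \<phi>: "0 \<le> \<phi> x" "\<phi> x \<le> 1" "ennreal (\<phi> x) \<le> \<psi> x" for x
      using enn2real_mono[of "min 1 (\<psi> x)" 1]
      by (auto simp: \<phi>_def ennreal_enn2real_if min_def top_unique)
    have \<phi>_leaf: "\<phi> y = \<phi> x" if "y \<in> leaf x" for x y
      using leaf_integral_leaf[OF that] by (simp add: \<phi>_def \<psi>_def)
    have int\<phi>: "integrable M (\<lambda>x. \<phi> x * f x powr p)"
      using \<phi> by (intro Bochner_Integration.integrable_bound[OF int])
        (auto simp: abs_mult mult_left_le_one_le)
    have intZ: "integrable M (indicat_real Z)"
      using fin by (simp add: top.not_eq_extremum)
    have key: "(\<integral>x. \<phi> x * f x powr p \<partial>M) \<le> e powr (p - 1) * measure M Z"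
      if e: "0 < e" "e \<le> 1" for e
    proof -
      \<comment> \<open>On each leaf a fraction \<open>e * \<phi> x\<close> of \<open>f\<close> is
        given up and the value \<open>e\<close> is added on \<open>Z\<close>. With leaf integral at
        least 1 for \<open>f\<close> and \<open>\<phi> x \<le> \<psi> x\<close>, the new leaf
        integral is at least \<open>(1 - e * \<phi> x) + e * \<phi> x\<close>.\<close>
      define h where "h x = (1 - e * \<phi> x) * f x + e * indicator Z x" for x
      have [measurable]: "h \<in> borel_measurable M" unfolding h_def by measurable
      have e\<phi>: "0 \<le> e * \<phi> x" "e * \<phi> x \<le> 1" for x
        using e \<phi>[of x] by (auto intro: mult_le_one)
      have h0: "0 \<le> h x" for x using e e\<phi> f0 by (simp add: h_def)
      have pw: "h x powr p \<le> f x powr p - e * (\<phi> x * f x powr p) + e powr p * indicator Z x" for x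
      proof (cases "x \<in> Z")
        case True
        then show ?thesis using fZ p by (simp add: h_def)
      next
        case False
        \<comment> \<open>The base lies in the unit interval and \<open>p > 1\<close>, so the power
          is at most the base itself; the saving thus becomes linear in \<open>e\<close>.\<close>
        have "(1 - e * \<phi> x) powr p \<le> (1 - e * \<phi> x) powr 1"
          using e\<phi>[of x] p by (intro powr_mono') auto
        then have "(1 - e * \<phi> x) powr p * f x powr p \<le> (1 - e * \<phi> x) * f x powr p"
          using e\<phi>[of x] by (intro mult_right_mono) auto
        then have "((1 - e * \<phi> x) * f x) powr p \<le> (1 - e * \<phi> x) * f x powr p"
          using e\<phi>[of x] f0[of x] by (simp add: powr_mult)
        then show ?thesis using False by (simp add: h_def left_diff_distrib mult.assoc)
      qed
      have int2: "integrable M (\<lambda>x. f x powr p - e * (\<phi> x * f x powr p) + e powr p * indicator Z x)"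
        using int int\<phi> intZ by simp
      have inth: "integrable M (\<lambda>x. h x powr p)"
      proof (rule Bochner_Integration.integrable_bound[OF int2])
        show "AE x in M. norm (h x powr p)
            \<le> norm (f x powr p - e * (\<phi> x * f x powr p) + e powr p * indicator Z x)"
          using order_trans[OF pw abs_ge_self] by (intro AE_I2) simp
      qed measurable
      have "AE x in M. 1 \<le> leaf_integral (\<lambda>y. ennreal (h y)) x"
        using adm
      proof eventually_elim
        case (elim x)
        have "1 = ennreal (1 - e * \<phi> x) * 1 + ennreal e * ennreal (\<phi> x)"
          using e\<phi>[of x] e \<phi>[of x] by (simp flip: ennreal_mult ennreal_plus)
        also have "\<dots> \<le> ennreal (1 - e * \<phi> x) * leaf_integral (\<lambda>y. ennreal (f y)) x + ennreal e * \<psi> x"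
          using elim \<phi>[of x] by (intro add_mono mult_mono) auto
        also have "\<dots> = leaf_integral (\<lambda>y. ennreal (1 - e * \<phi> y) * ennreal (f y)) x
            + leaf_integral (\<lambda>y. ennreal e * indicator Z y) x"
          using \<phi>_leaf by (subst (1 2) leaf_integral_saturated_mult) (auto simp: \<psi>_def)
        also have "\<dots> = leaf_integral (\<lambda>y. ennreal (1 - e * \<phi> y) * ennreal (f y) + ennreal e * indicator Z y) x"
          unfolding leaf_integral_def
          by (intro nn_integral_add[symmetric] measurable_leaf) measurable
        also have "(\<lambda>y. ennreal (1 - e * \<phi> y) * ennreal (f y) + ennreal e * indicator Z y) = (\<lambda>y. ennreal (h y))"
          using e e\<phi> f0 by (auto simp: h_def fun_eq_iff indicator_def simp flip: ennreal_mult ennreal_plus)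
        finally show ?case .
      qed
      then have "admissible p h"
        using h0 inth by (simp add: admissible_def)
      from min[OF this] have "(\<integral>x. f x powr p \<partial>M) \<le> (\<integral>x. h x powr p \<partial>M)" .
      also have "\<dots> \<le> (\<integral>x. f x powr p - e * (\<phi> x * f x powr p) + e powr p * indicator Z x \<partial>M)"
        using pw by (intro integral_mono inth int2)
      also have "\<dots> = (\<integral>x. f x powr p \<partial>M) - e * (\<integral>x. \<phi> x * f x powr p \<partial>M) + e powr p * measure M Z"
        using int int\<phi> intZ by simp
      \<comment> \<open>The saving is of order \<open>e\<close> and the cost of order
        \<open>e powr p\<close>; one factor \<open>e\<close> cancels.\<close>
      finally have "e * (\<integral>x. \<phi> x * f x powr p \<partial>M) \<le> e * (e powr (p - 1) * measure M Z)"
        using e by (simp add: powr_diff)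
      then show ?thesis using e by simp
    qed
    \<comment> \<open>Since \<open>p > 1\<close>, the limit \<open>0 powr (p - 1)\<close> is
      0.\<close>
    have "((\<lambda>e. e powr (p - 1) * measure M Z) \<longlongrightarrow> 0 powr (p - 1) * measure M Z) (at_right 0)"
      using p by (intro tendsto_intros tendsto_powr2) (auto simp: eventually_at_filter)
    moreover have "eventually (\<lambda>e. e \<in> {0<..<1::real}) (at_right 0)"
      by (rule eventually_at_right_real) simp
    ultimately have "(\<integral>x. \<phi> x * f x powr p \<partial>M) \<le> 0"
      using p by (intro tendsto_lowerbound[where f="\<lambda>e. e powr (p - 1) * measure M Z" and F="at_right 0"])
        (auto elim!: eventually_mono intro: key)
    moreover have "0 \<le> (\<integral>x. \<phi> x * f x powr p \<partial>M)"
      using \<phi> by (intro integral_nonneg_AE) auto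
    ultimately have "AE x in M. \<phi> x * f x powr p = 0"
      using \<phi> int\<phi> by (subst integral_nonneg_eq_0_iff_AE[symmetric]) auto
    moreover have \<phi>\<psi>: "\<phi> x = 0 \<longleftrightarrow> \<psi> x = 0" for x
      by (auto simp: \<phi>_def enn2real_eq_0_iff min_def)
    ultimately have "AE x in M. x \<in> {x. \<psi> x \<noteq> 0} \<longrightarrow> f x = 0"
      by (auto elim!: eventually_mono)
    moreover have s: "{x. \<psi> x \<noteq> 0} \<in> sets M"
    proof -
      have "{x \<in> space M. \<psi> x \<noteq> 0} \<in> sets M" by measurable
      then show ?thesis by simp
    qed
    \<comment> \<open>\<open>f\<close> vanishes almost everywhere on the saturated set of leaves
      that charge \<open>Z\<close>, so these leaves form a null set, and \<open>null_iff\<close>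
      makes \<open>Z\<close> null.\<close>
    ultimately have "AE x in M. x \<notin> {x. \<psi> x \<noteq> 0}"
      using adm leaf_integral_leaf
      by (intro saturated_AE_notin[where f="\<lambda>x. ennreal (f x)"]) (auto simp: \<psi>_def)
    then have "{x. \<psi> x \<noteq> 0} \<in> null_sets M"
      using s by (subst (asm) AE_iff_null) auto
    then show ?thesis
      using null_iff[OF that(1)] by (simp add: \<psi>_def leaf_integral_indicator)
  qed
  obtain A :: "nat \<Rightarrow> 'a set" where A: "range A \<subseteq> sets M" "(\<Union>i. A i) = space M" "\<And>i. emeasure M (A i) \<noteq> \<infinity>"
    using sigma_finite_measure.sigma_finite[OF sigma_finite] by metis
  have f0s: "{x. f x = 0} \<in> sets M"
  proof -
    have "{x \<in> space M. f x = 0} \<in> sets M" by measurable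
    then show ?thesis by simp
  qed
  have "{x. f x = 0} \<inter> A i \<in> null_sets M" for i
  proof (rule Z)
    show "emeasure M ({x. f x = 0} \<inter> A i) \<noteq> \<infinity>"
      using A emeasure_mono[of "{x. f x = 0} \<inter> A i" "A i" M] by (auto simp: top_unique)
  qed (use A f0s in auto)
  then have "(\<Union>i. {x. f x = 0} \<inter> A i) \<in> null_sets M" by (rule null_sets_UN)
  moreover have "(\<Union>i. {x. f x = 0} \<inter> A i) = {x. f x = 0}" using A by auto
  ultimately have "AE x in M. x \<notin> {x. f x = 0}" by (intro AE_not_in) simp
  then show ?thesis
    by eventually_elim (use f0 in \<open>auto simp: less_le\<close>)
qed

text \<open>The extremal function is measurable for the completion, whereas the minimizer lemmas
  concern Borel functions. A Borel representative has the same integral of p-th powers and, on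
  almost every leaf, the same leaf integral.\<close>

theorem extremal_leaf_integral_pos:
  assumes p: "p > 1" and ext: "extremal (completion M) (range leaf) \<nu> p f\<^sub>0"
  shows "almost_every_leaf (completion M) (range leaf) (\<lambda>L. (\<integral>\<^sup>+ x. ennreal (f\<^sub>0 x) \<partial>\<nu> L) = 1)"
    and "AE x in completion M. f\<^sub>0 x > 0"
proof -
  have f0: "f\<^sub>0 \<in> borel_measurable (completion M)" "integrable (completion M) (\<lambda>x. \<bar>f\<^sub>0 x\<bar> powr p)"
    "\<And>x. 0 \<le> f\<^sub>0 x" "AE x in M. 1 \<le> leaf_integral (\<lambda>y. ennreal (f\<^sub>0 y)) x"
    using ext by (auto simp: extremal_def adm_def Lp_space_def almost_every_leaf_iff_AE leaf_integral_def)
  obtain f' where [measurable]: "f' \<in> borel_measurable M" and "AE x in M. f\<^sub>0 x = f' x"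
    using completion_ex_borel_measurable_real[OF f0(1)] by auto
  \<comment> \<open>The maximum restores nonnegativity everywhere, as \<open>admissible\<close>
    demands; equality almost everywhere survives because \<open>f\<^sub>0\<close> is
    nonnegative.\<close>
  define f where "f x = max 0 (f' x)" for x
  have [measurable]: "f \<in> borel_measurable M" unfolding f_def by measurable
  have eq: "AE x in M. f\<^sub>0 x = f x"
    using \<open>AE x in M. f\<^sub>0 x = f' x\<close> by eventually_elim (metis f0(3) f_def max.absorb2)
  have eqc: "AE x in completion M. \<bar>f\<^sub>0 x\<bar> powr p = f x powr p"
    using AE_completion[OF eq] by eventually_elim (simp add: f_def)
  have fpm: "(\<lambda>x. f x powr p) \<in> borel_measurable (completion M)"
    by (rule measurable_completion) measurable
  have f0m: "(\<lambda>x. \<bar>f\<^sub>0 x\<bar> powr p) \<in> borel_measurable (completion M)" using f0(2) by auto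
  have int: "integrable M (\<lambda>x. f x powr p)"
    using integrable_cong_AE[OF f0m fpm eqc] f0(2) by (simp add: integrable_completion)
  have I: "(\<integral>x. \<bar>f\<^sub>0 x\<bar> powr p \<partial>completion M) = (\<integral>x. f x powr p \<partial>M)"
    using integral_cong_AE[OF f0m fpm eqc] by (simp add: integral_completion)
  have leq: "AE x in M. leaf_integral (\<lambda>y. ennreal (f\<^sub>0 y)) x = leaf_integral (\<lambda>y. ennreal (f y)) x"
    using eq by (intro leaf_integral_cong_AE) (auto elim: eventually_mono)
  have "admissible p f"
    using leq f0(4) int by (auto simp: admissible_def f_def[abs_def] elim!: eventually_elim2)
  moreover have "(\<integral>x. f x powr p \<partial>M) \<le> (\<integral>x. h x powr p \<partial>M)" if h: "admissible p h" for h
  proof -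
    have [measurable]: "h \<in> borel_measurable M" and "integrable M (\<lambda>x. h x powr p)" "\<And>x. 0 \<le> h x"
      using h by (auto simp: admissible_def)
    moreover have "h \<in> borel_measurable (completion M)" by (rule measurable_completion) measurable
    ultimately have "h \<in> adm (completion M) (range leaf) \<nu> p"
      using h by (auto simp: adm_def Lp_space_def admissible_def almost_every_leaf_iff_AE
          leaf_integral_def integrable_completion)
    then have "modulus (completion M) (range leaf) \<nu> p \<le> ennreal (Lp_norm (completion M) p h)"
      by (auto simp: modulus_def intro: INF_lower)
    then have "ennreal (Lp_norm (completion M) p f\<^sub>0) \<le> ennreal (Lp_norm (completion M) p h)"
      using ext by (simp add: extremal_def)
    then have "Lp_norm (completion M) p f\<^sub>0 \<le> Lp_norm (completion M) p h"
      by (subst (asm) ennreal_le_iff) (auto simp: Lp_norm_def)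
    moreover have "Lp_norm (completion M) p h = (\<integral>x. h x powr p \<partial>M) powr (1 / p)"
      using \<open>\<And>x. 0 \<le> h x\<close> by (simp add: Lp_norm_def integral_completion)
    moreover have "Lp_norm (completion M) p f\<^sub>0 = (\<integral>x. f x powr p \<partial>M) powr (1 / p)"
      using I by (simp add: Lp_norm_def)
    ultimately have *: "(\<integral>x. f x powr p \<partial>M) powr (1 / p) \<le> (\<integral>x. h x powr p \<partial>M) powr (1 / p)"
      by simp
    show ?thesis
    proof (rule ccontr)
      assume "\<not> ?thesis"
      then have "(\<integral>x. h x powr p \<partial>M) powr (1 / p) < (\<integral>x. f x powr p \<partial>M) powr (1 / p)"
        using p by (intro powr_less_mono2) (auto intro: integral_nonneg_AE)
      with * show False by simp
    qed
  qed
  ultimately have "minimizer p f" by (simp add: minimizer_def)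
  have "AE x in M. leaf_integral (\<lambda>y. ennreal (f\<^sub>0 y)) x = 1"
    using leq minimizer_leaf_integral[OF _ \<open>minimizer p f\<close>] p by auto
  then show "almost_every_leaf (completion M) (range leaf) (\<lambda>L. (\<integral>\<^sup>+ x. ennreal (f\<^sub>0 x) \<partial>\<nu> L) = 1)"
    by (simp add: almost_every_leaf_iff_AE leaf_integral_def)
  have "AE x in M. f\<^sub>0 x > 0"
    using eq minimizer_pos[OF p \<open>minimizer p f\<close>] by eventually_elim simp
  then show "AE x in completion M. f\<^sub>0 x > 0" by (rule AE_completion)
qed

end

section \<open>Fubini and determinants in coordinates\<close>

lemma borel_measurable_vec:
  fixes f :: "'a \<Rightarrow> real ^ 'n"
  assumes "\<And>i. (\<lambda>x. f x $ i) \<in> borel_measurable M"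
  shows "f \<in> borel_measurable M"
  by (subst borel_measurable_euclidean_space) (use assms in \<open>auto simp: Basis_vec_def inner_axis\<close>)

lemma borel_measurable_vec_nth [measurable]: "(\<lambda>x::real^'n. x $ i) \<in> borel_measurable borel"
  by (intro borel_measurable_continuous_onI continuous_intros)

lemma measurable_splice [measurable]:
  "(\<lambda>(t, y). splice K y t) \<in> borel_measurable (borel \<Otimes>\<^sub>M (\<Pi>\<^sub>M i\<in>K. lborel))"
proof (rule borel_measurable_vec)
  fix i
  show "(\<lambda>x. (case x of (t, y) \<Rightarrow> splice K y t) $ i) \<in> borel_measurable (borel \<Otimes>\<^sub>M (\<Pi>\<^sub>M i\<in>K. lborel))"
    by (cases "i \<in> K") (auto simp: splice_def case_prod_unfold)
qed

text \<open>Lebesgue measure is determined by its values on boxes. The product form allows the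
  coordinates to be split into those in \<open>K\<close> and those in \<open>- K\<close>.\<close>

lemma lborel_vec_eq_PiM:
  "(lborel :: (real ^ 'n) measure) = distr (\<Pi>\<^sub>M i\<in>UNIV. lborel) borel vec_lambda"
proof (rule lborel_eqI)
  interpret product_sigma_finite "\<lambda>i::'n. lborel :: real measure" ..
  have [measurable]: "(vec_lambda :: _ \<Rightarrow> real ^ 'n) \<in> borel_measurable (\<Pi>\<^sub>M i\<in>UNIV. lborel)"
    by (rule borel_measurable_vec) simp
  fix l u :: "real ^ 'n"
  assume lu: "\<And>b. b \<in> Basis \<Longrightarrow> l \<bullet> b \<le> u \<bullet> b"
  have le: "l $ i \<le> u $ i" for i
    using lu[of "axis i 1"] by (simp add: inner_axis axis_in_Basis_iff)
  have "emeasure (distr (\<Pi>\<^sub>M i\<in>UNIV. lborel) borel vec_lambda) (box l u) =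
      emeasure (\<Pi>\<^sub>M i\<in>UNIV. lborel) (vec_lambda -` box l u \<inter> space (\<Pi>\<^sub>M i\<in>UNIV. lborel))"
    by (rule emeasure_distr) auto
  also have "vec_lambda -` box l u \<inter> space (\<Pi>\<^sub>M i\<in>UNIV. lborel) = Pi\<^sub>E UNIV (\<lambda>i. {l $ i<..<u $ i})"
    by (auto simp: space_PiM mem_box_cart PiE_def Pi_def)
  also have "emeasure (\<Pi>\<^sub>M i\<in>UNIV. lborel) \<dots> = (\<Prod>i\<in>UNIV. ennreal (u $ i - l $ i))"
    using le by (subst emeasure_PiM) auto
  also have "\<dots> = ennreal (\<Prod>i\<in>UNIV. u $ i - l $ i)"
    using le by (intro prod_ennreal) simp
  also have "(\<Prod>i\<in>UNIV. u $ i - l $ i) = (\<Prod>b\<in>Basis. (u - l) \<bullet> b)"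
  proof -
    have B: "(Basis :: (real ^ 'n) set) = (\<lambda>i. axis i 1) ` UNIV" by (auto simp: Basis_vec_def)
    have "inj (\<lambda>i::'n. axis i (1::real))" by (auto simp: inj_def axis_eq_axis)
    then show ?thesis unfolding B by (subst prod.reindex) (auto simp: inner_axis)
  qed
  finally show "emeasure (distr (\<Pi>\<^sub>M i\<in>UNIV. lborel) borel vec_lambda) (box l u) = (\<Prod>b\<in>Basis. (u - l) \<bullet> b)" .
qed simp

text \<open>Only the coordinates of \<open>t\<close> outside \<open>K\<close> matter. Indexing
  slices by full vectors lets the coordinates of any point of a chart name its slice.\<close>

definition slice_measure :: "'n set \<Rightarrow> (real ^ 'n) set \<Rightarrow> real ^ 'n \<Rightarrow> ennreal" where
  "slice_measure K S t = (\<integral>\<^sup>+ y. indicator S (splice K y t) \<partial>(\<Pi>\<^sub>M i\<in>K. lborel))"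

lemma borel_measurable_slice_integral:
  fixes G :: "real ^ 'n \<Rightarrow> ennreal"
  assumes [measurable]: "G \<in> borel_measurable borel"
  shows "(\<lambda>t. \<integral>\<^sup>+ y. G (splice K y t) \<partial>(\<Pi>\<^sub>M i\<in>K. lborel)) \<in> borel_measurable borel"
proof -
  interpret finite_product_sigma_finite "\<lambda>i::'n. lborel :: real measure" K
    by standard simp
  have "(\<lambda>p. G (case p of (t, y) \<Rightarrow> splice K y t)) \<in> borel_measurable (borel \<Otimes>\<^sub>M (\<Pi>\<^sub>M i\<in>K. lborel))"
    by measurable
  then have "(\<lambda>(t, y). G (splice K y t)) \<in> borel_measurable (borel \<Otimes>\<^sub>M (\<Pi>\<^sub>M i\<in>K. lborel))"
    by (simp add: case_prod_unfold)
  from borel_measurable_nn_integral[OF this] show ?thesis .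
qed

lemma borel_measurable_slice_measure [measurable]:
  "S \<in> sets borel \<Longrightarrow> slice_measure K S \<in> borel_measurable borel"
  unfolding slice_measure_def[abs_def]
  by (intro borel_measurable_slice_integral borel_measurable_indicator) auto

text \<open>Fubini's theorem, with the exceptional slices collected in the full space instead of the
  transverse one: slice measures are constant along the \<open>K\<close> directions, so the
  exceptional set is a cylinder, and a cylinder is null iff its base is.\<close>

lemma null_sets_lborel_iff_slices:
  fixes S :: "(real ^ 'n) set"
  assumes [measurable]: "S \<in> sets borel"
  shows "S \<in> null_sets lborel \<longleftrightarrow> (AE t in lborel. slice_measure K S t = 0)"
proof -
  interpret product_sigma_finite "\<lambda>i::'n. lborel :: real measure" ..
  interpret fK: finite_product_sigma_finite "\<lambda>i::'n. lborel :: real measure" K by standard simp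
  let ?N = "\<Pi>\<^sub>M i\<in>K. (lborel :: real measure)" and ?N' = "\<Pi>\<^sub>M i\<in>-K. (lborel :: real measure)"
  define m where "m z y = (vec_lambda (merge (- K) K (z, y)) :: real ^ 'n)" for z y
  have [measurable]: "(vec_lambda :: _ \<Rightarrow> real ^ 'n) \<in> borel_measurable (\<Pi>\<^sub>M i\<in>UNIV. lborel)"
    by (rule borel_measurable_vec) simp
  have m_meas [measurable]: "(\<lambda>(z, y). m z y) \<in> borel_measurable (?N' \<Otimes>\<^sub>M ?N)"
  proof -
    have "merge (- K) K \<in> measurable (?N' \<Otimes>\<^sub>M ?N) (\<Pi>\<^sub>M i\<in>-K \<union> K. lborel)" by measurable
    then have "merge (- K) K \<in> measurable (?N' \<Otimes>\<^sub>M ?N) (\<Pi>\<^sub>M i\<in>UNIV. lborel)" by (simp add: Un_commute)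
    from measurable_compose[OF this \<open>vec_lambda \<in> _\<close>] show ?thesis
      by (simp add: m_def case_prod_unfold)
  qed
  have fub: "(\<integral>\<^sup>+ x. G x \<partial>lborel) = (\<integral>\<^sup>+ z. (\<integral>\<^sup>+ y. G (m z y) \<partial>?N) \<partial>?N')"
    if [measurable]: "G \<in> borel_measurable borel" for G
  proof -
    have "(\<integral>\<^sup>+ x. G x \<partial>lborel) = (\<integral>\<^sup>+ x. G (vec_lambda x) \<partial>(\<Pi>\<^sub>M i\<in>UNIV. lborel))"
      by (subst lborel_vec_eq_PiM, subst nn_integral_distr) auto
    also have "\<dots> = (\<integral>\<^sup>+ x. G (vec_lambda x) \<partial>(\<Pi>\<^sub>M i\<in>-K \<union> K. lborel))"
      by (simp add: Un_commute)
    also have "\<dots> = (\<integral>\<^sup>+ z. (\<integral>\<^sup>+ y. G (m z y) \<partial>?N) \<partial>?N')"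
      unfolding m_def by (rule product_nn_integral_fold) (auto simp: Un_commute)
    finally show ?thesis .
  qed
  have spl: "splice K y (m z y') = m z y" for y y' z
    by (auto simp: splice_def m_def merge_def vec_eq_iff)
  define \<psi> where "\<psi> z = (\<integral>\<^sup>+ y. indicator S (m z y) \<partial>?N)" for z
  have [measurable]: "\<psi> \<in> borel_measurable ?N'"
    unfolding \<psi>_def by (intro fK.borel_measurable_nn_integral) (simp add: case_prod_unfold, measurable)
  \<comment> \<open>The total mass is infinite, or 1 for the empty product
    \<open>K = {}\<close>.\<close>
  have vol: "emeasure ?N (space ?N) \<noteq> 0"
    by (simp add: space_PiM emeasure_PiM)
  have "S \<in> null_sets lborel \<longleftrightarrow> (\<integral>\<^sup>+ x. indicator S x \<partial>lborel) = 0"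
    by (simp add: null_sets_def)
  also have "\<dots> \<longleftrightarrow> (AE z in ?N'. \<psi> z = 0)"
    by (subst fub) (auto simp: \<psi>_def[symmetric] nn_integral_0_iff_AE)
  \<comment> \<open>A nonzero factor does not affect vanishing; it is the inner integral of the
    function \<open>\<psi> z\<close>, constant in the \<open>K\<close> directions, and so prepares
    for applying \<open>fub\<close> backwards.\<close>
  also have "\<dots> \<longleftrightarrow> (\<integral>\<^sup>+ z. \<psi> z * emeasure ?N (space ?N) \<partial>?N') = 0"
    using vol by (simp add: nn_integral_0_iff_AE)
  also have "\<dots> \<longleftrightarrow> (\<integral>\<^sup>+ t. slice_measure K S t \<partial>lborel) = 0"
    by (subst fub) (auto simp: slice_measure_def spl \<psi>_def)
  also have "\<dots> \<longleftrightarrow> (AE t in lborel. slice_measure K S t = 0)"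
    by (simp add: nn_integral_0_iff_AE)
  finally show ?thesis .
qed

lemma slice_measure_mono:
  "(\<And>y. splice K y t \<in> S \<Longrightarrow> splice K y t \<in> T) \<Longrightarrow> slice_measure K S t \<le> slice_measure K T t"
  unfolding slice_measure_def by (intro nn_integral_mono) (auto simp: indicator_def)

text \<open>\<open>U\<close> contains an open box around the given point, and the \<open>K\<close>
  face of that box has positive volume.\<close>

lemma slice_measure_open_pos:
  assumes "open U" and "splice K y\<^sub>0 t \<in> U"
  shows "slice_measure K U t \<noteq> 0"
proof
  assume 0: "slice_measure K U t = 0"
  interpret product_sigma_finite "\<lambda>i. lborel :: real measure" ..
  obtain A where A: "\<And>i. open (A i)" "\<And>i. splice K y\<^sub>0 t $ i \<in> A i"
    and AU: "\<And>x. (\<And>i. x $ i \<in> A i) \<Longrightarrow> x \<in> U"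
    using assms unfolding open_vec_def by metis
  have U: "U \<in> sets borel" using assms(1) by simp
  have "emeasure (\<Pi>\<^sub>M i\<in>K. lborel) (Pi\<^sub>E K A) = (\<integral>\<^sup>+ y. indicator (Pi\<^sub>E K A) y \<partial>(\<Pi>\<^sub>M i\<in>K. lborel))"
    using A by (subst nn_integral_indicator) (auto intro!: sets_PiM_I_finite)
  also have "\<dots> \<le> slice_measure K U t"
    unfolding slice_measure_def
  proof (intro nn_integral_mono)
    fix y
    have "splice K y t \<in> U" if "y \<in> Pi\<^sub>E K A"
      using that A(2) by (intro AU) (auto simp: splice_def PiE_def Pi_def split: if_splits, meson)
    then show "indicator (Pi\<^sub>E K A) y \<le> (indicator U (splice K y t) :: ennreal)"
      by (auto simp: indicator_def)
  qed
  finally have "(\<Prod>i\<in>K. emeasure lborel (A i)) = 0"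
    using 0 A by (subst (asm) emeasure_PiM) auto
  then obtain i where "i \<in> K" "emeasure lborel (A i) = 0" by auto
  then have "A i \<in> null_sets lborel" using A by (simp add: null_sets_def)
  then have "negligible (A i)" by (simp add: negligible_iff_null_sets null_sets_completionI)
  then show False using open_not_negligible[of "A i"] A by auto
qed

section \<open>Determinants of positive definite matrices\<close>

lemma continuous_on_det [continuous_intros]:
  fixes f :: "'a::topological_space \<Rightarrow> real ^ 'n ^ 'n"
  assumes "continuous_on S f"
  shows "continuous_on S (\<lambda>x. det (f x))"
  unfolding det_def using assms by (intro continuous_intros)

text \<open>On the segment \<open>H\<close> from the identity to \<open>G\<close> every matrix is
  positive definite, hence has trivial kernel. The determinant starts at 1 and cannot cross
  0.\<close>

lemma det_pos_if_positive_definite: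
  fixes G :: "real ^ 'n ^ 'n"
  assumes G: "\<And>v. v \<noteq> 0 \<Longrightarrow> v \<bullet> (G *v v) > 0"
  shows "det G > 0"
proof (rule ccontr)
  assume neg: "\<not> det G > 0"
  define H where "H s = (1 - s) *\<^sub>R mat 1 + s *\<^sub>R G" for s
  have "\<exists>s\<ge>0. s \<le> 1 \<and> det (H s) = 0"
    using neg unfolding H_def
    by (intro IVT2') (auto intro!: continuous_intros)
  then obtain s where s: "0 \<le> s" "s \<le> 1" "det (H s) = 0" by auto
  then obtain v where v: "v \<noteq> 0" "H s *v v = 0"
    using invertible_det_nz[of "H s"] matrix_left_invertible_ker[of "H s"] by (auto simp: invertible_left_inverse)
  have "v \<bullet> (H s *v v) = (1 - s) * (v \<bullet> v) + s * (v \<bullet> (G *v v))"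
    by (simp add: H_def matrix_vector_mult_add_rdistrib scaleR_matrix_vector_assoc[symmetric] inner_add_right)
  moreover have "0 < (1 - s) * (v \<bullet> v) + s * (v \<bullet> (G *v v))"
  proof (cases "s = 0")
    case True then show ?thesis using v by simp
  next
    case False
    then show ?thesis using s v G[of v] by (intro add_nonneg_pos) auto
  qed
  ultimately show False using v by simp
qed

text \<open>The modified matrix is block diagonal: its quadratic form is that of \<open>G\<close> on
  the \<open>K\<close> part \<open>w\<close> of \<open>v\<close> plus the squared norm of the
  remaining part \<open>u\<close>.\<close>

lemma minor_det_pos:
  fixes G :: "real ^ 'n ^ 'n"
  assumes G: "\<And>v. v \<noteq> 0 \<Longrightarrow> v \<bullet> (G *v v) > 0"
  shows "minor_det K G > 0"
  unfolding minor_det_def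
proof (rule det_pos_if_positive_definite)
  fix v :: "real ^ 'n" assume v: "v \<noteq> 0"
  let ?H = "(\<chi> i j. if i \<in> K \<and> j \<in> K then G $ i $ j else if i = j then 1 else 0) :: real ^ 'n ^ 'n"
  define w where "w = (\<chi> i. if i \<in> K then v $ i else 0)"
  define u where "u = (\<chi> i. if i \<in> K then 0 else v $ i)"
  have H: "(?H *v v) $ i = (if i \<in> K then (G *v w) $ i else v $ i)" for i
  proof (cases "i \<in> K")
    case True
    have "(?H *v v) $ i = (\<Sum>j\<in>UNIV. G $ i $ j * w $ j)"
      unfolding matrix_vector_mult_def w_def using True by (auto intro!: sum.cong)
    then show ?thesis using True by (simp add: matrix_vector_mult_def)
  next
    case False
    have "(?H *v v) $ i = (\<Sum>j\<in>UNIV. if i = j then v $ j else 0)"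
      unfolding matrix_vector_mult_def using False by (simp add: if_distrib[of "\<lambda>x. x * _"] cong: if_cong)
    then show ?thesis using False by simp
  qed
  have "v \<bullet> (?H *v v) = w \<bullet> (G *v w) + u \<bullet> u"
    unfolding inner_vec_def H sum.distrib[symmetric]
    by (intro sum.cong) (auto simp: w_def u_def)
  moreover have "w \<noteq> 0 \<or> u \<noteq> 0"
    using v by (auto simp: w_def u_def vec_eq_iff)
  ultimately show "v \<bullet> (?H *v v) > 0"
    using G[of w] by (cases "w = 0") (auto intro: add_pos_nonneg)
qed

lemma continuous_on_minor_det [continuous_intros]:
  fixes f :: "'a::topological_space \<Rightarrow> real ^ 'n ^ 'n"
  assumes "continuous_on S f"
  shows "continuous_on S (\<lambda>x. minor_det K (f x))"
  unfolding minor_det_def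
proof (intro continuous_on_det continuous_on_vec_lambda)
  fix i j show "continuous_on S (\<lambda>x. if i \<in> K \<and> j \<in> K then f x $ i $ j else if i = j then 1 else 0)"
    using assms by (cases "i \<in> K \<and> j \<in> K") (auto intro!: continuous_intros)
qed

lemma minor_det_UNIV: "minor_det UNIV G = det G"
  by (simp add: minor_det_def vec_nth_inverse)

section \<open>Charts and the Riemannian measure\<close>

abbreviation cimg :: "('a, 'n) chart \<Rightarrow> (real ^ 'n) set" where
  "cimg c \<equiv> cmap c ` cdom c"

abbreviation cinv :: "('a, 'n) chart \<Rightarrow> real ^ 'n \<Rightarrow> 'a" where
  "cinv c \<equiv> inv_into (cdom c) (cmap c)"

context
  fixes c :: "('a::topological_space, 'n::finite) chart"
  assumes c: "is_chart c"
begin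

lemma open_cdom: "open (cdom c)" and open_cimg: "open (cimg c)"
  using c by (auto simp: is_chart_def)

lemma inj_on_cmap: "inj_on (cmap c) (cdom c)"
  using c by (auto simp: is_chart_def homeomorphism_def intro: inj_on_inverseI)

lemma homeomorphism_chart: "homeomorphism (cdom c) (cimg c) (cmap c) (cinv c)"
proof -
  obtain \<psi> where \<psi>: "homeomorphism (cdom c) (cimg c) (cmap c) \<psi>"
    using c by (auto simp: is_chart_def)
  then show ?thesis
    by (rule homeomorphism_cong)
      (use \<psi> inj_on_cmap in \<open>auto simp: homeomorphism_def inv_into_f_f\<close>)
qed

lemma continuous_on_cmap: "continuous_on (cdom c) (cmap c)"
  and continuous_on_cinv: "continuous_on (cimg c) (cinv c)"
  using homeomorphism_chart by (auto simp: homeomorphism_def)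

lemma cinv_cmap: "x \<in> cdom c \<Longrightarrow> cinv c (cmap c x) = x"
  using inj_on_cmap by (rule inv_into_f_f)

lemma cinv_in_cdom: "z \<in> cimg c \<Longrightarrow> cinv c z \<in> cdom c"
  and cmap_cinv: "z \<in> cimg c \<Longrightarrow> cmap c (cinv c z) = z"
  using inj_on_cmap by auto

lemma open_cmap_image:
  assumes "open W" shows "open (cmap c ` (W \<inter> cdom c))"
proof -
  have "openin (top_of_set (cdom c)) (W \<inter> cdom c)"
    using assms by (auto simp: openin_open)
  then have "openin (top_of_set (cimg c)) (cmap c ` (W \<inter> cdom c))"
    by (rule homeomorphism_imp_open_map[OF homeomorphism_chart])
  then show ?thesis using open_cimg by (rule openin_open_trans)
qed

text \<open>The image is the preimage of \<open>E\<close> under the continuous inverse of the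
  chart.\<close>

lemma cmap_image_borel:
  assumes "E \<in> sets borel" shows "cmap c ` (E \<inter> cdom c) \<in> sets borel"
proof -
  have "cinv c -` E \<inter> space (restrict_space borel (cimg c)) \<in> sets (restrict_space borel (cimg c))"
    using borel_measurable_continuous_on_restrict[OF continuous_on_cinv] assms by (rule measurable_sets)
  then have "cinv c -` E \<inter> cimg c \<in> sets borel"
    using open_cimg by (subst (asm) sets_restrict_space_iff) (auto simp: space_restrict_space)
  moreover have "cinv c -` E \<inter> cimg c = cmap c ` (E \<inter> cdom c)"
    using cinv_cmap by auto
  ultimately show ?thesis by simp
qed

lemma cmap_vimage_borel:
  assumes "T \<in> sets borel" shows "cmap c -` T \<inter> cdom c \<in> sets borel"
proof -
  have "cmap c -` T \<inter> space (restrict_space borel (cdom c)) \<in> sets (restrict_space borel (cdom c))"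
    using borel_measurable_continuous_on_restrict[OF continuous_on_cmap] assms by (rule measurable_sets)
  then show ?thesis
    using open_cdom by (subst (asm) sets_restrict_space_iff) (auto simp: space_restrict_space)
qed

end

text \<open>Lindelof's theorem provides a countable subcover, so the choice in
  \<open>chart_seq\<close> has a witness.\<close>

lemma chart_seq:
  fixes C :: "('a::second_countable_topology, 'n::finite) chart set"
  assumes ch: "\<And>c. c \<in> C \<Longrightarrow> is_chart c" and cov: "(\<Union>c\<in>C. cdom c) = UNIV"
  shows "range (chart_seq C) \<subseteq> C" "(\<Union>i. cdom (chart_seq C i)) = UNIV"
proof -
  obtain F where F: "F \<subseteq> cdom ` C" "countable F" "\<Union>F = \<Union>(cdom ` C)"
    by (rule Lindelof[of "cdom ` C"]) (auto dest: ch intro: open_cdom)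
  obtain D where D: "D \<subseteq> C" "countable D" "F = cdom ` D"
    using F(1,2) countable_subset_image[of F cdom C] by auto
  have "D \<noteq> {}" using F(3) cov D by auto
  have "range (from_nat_into D) = D"
    using D(2) \<open>D \<noteq> {}\<close> by (rule range_from_nat_into[rotated])
  then have "range (from_nat_into D) \<subseteq> C \<and> (\<Union>i. cdom (from_nat_into D i)) = UNIV"
  proof (intro conjI)
    have "(\<Union>i. cdom (from_nat_into D i)) = (\<Union>c\<in>range (from_nat_into D). cdom c)" by blast
    then show "(\<Union>i. cdom (from_nat_into D i)) = UNIV"
      using \<open>range (from_nat_into D) = D\<close> D(3) F(3) cov by simp
  qed (use \<open>range (from_nat_into D) = D\<close> D(1) in simp)
  then have "range (chart_seq C) \<subseteq> C \<and> (\<Union>i. cdom (chart_seq C i)) = UNIV"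
    unfolding chart_seq_def by (rule someI[where P="\<lambda>s. range s \<subseteq> C \<and> (\<Union>i. cdom (s i)) = UNIV"])
  then show "range (chart_seq C) \<subseteq> C" "(\<Union>i. cdom (chart_seq C i)) = UNIV" by auto
qed

lemma piece_subset: "piece s i \<subseteq> cdom (s i)"
  by (auto simp: piece_def)

lemma UN_piece: "(\<Union>i. piece s i) = (\<Union>i. cdom (s i))"
proof -
  have "\<exists>j. x \<in> piece s j" if "x \<in> cdom (s i)" for x i
    using that
  proof (induction i rule: less_induct)
    case (less i)
    then show ?case by (cases "\<exists>j<i. x \<in> cdom (s j)") (auto simp: piece_def)
  qed
  then show ?thesis using piece_subset by fastforce
qed

lemma disjoint_piece: "i \<noteq> j \<Longrightarrow> piece s i \<inter> piece s j = {}"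
  by (cases "i < j") (auto simp: piece_def)

lemma piece_borel:
  assumes "\<And>i. is_chart (s i)" shows "piece s i \<in> sets borel"
proof -
  have "open (\<Union>j<i. cdom (s j))" by (intro open_UN ballI open_cdom assms)
  then show ?thesis unfolding piece_def using open_cdom[OF assms] by (intro sets.Diff) auto
qed

lemma cmap_piece_borel:
  assumes "\<And>i. is_chart (s i)" and "E \<in> sets borel"
  shows "cmap (s i) ` (E \<inter> piece s i) \<in> sets borel"
proof -
  have "E \<inter> piece s i = (E \<inter> piece s i) \<inter> cdom (s i)" using piece_subset[of s i] by auto
  then show ?thesis
    using cmap_image_borel[OF assms(1)] piece_borel[of s i] assms by (metis sets.Int)
qed

text \<open>Injectivity of the chart keeps images of disjoint sets disjoint. This is the core of
  countable additivity for both the volume and the leaf measures.\<close>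

lemma indicator_cmap_UN:
  assumes "is_chart c" and "S \<subseteq> cdom c" and "disjoint_family X"
  shows "(indicator (cmap c ` ((\<Union>n. X n) \<inter> S)) z :: ennreal)
    = (\<Sum>n. indicator (cmap c ` (X n \<inter> S)) z)"
proof -
  have "disjoint_family (\<lambda>n. cmap c ` (X n \<inter> S))"
    unfolding disjoint_family_on_def
  proof (intro ballI impI)
    fix m n :: nat assume "m \<noteq> n"
    then have "(X m \<inter> S) \<inter> (X n \<inter> S) = {}" using assms(3) by (auto simp: disjoint_family_on_def)
    then show "cmap c ` (X m \<inter> S) \<inter> cmap c ` (X n \<inter> S) = {}"
      using inj_on_image_Int[OF inj_on_cmap[OF assms(1)], of "X m \<inter> S" "X n \<inter> S"] assms(2) by auto
  qed
  moreover have "cmap c ` ((\<Union>n. X n) \<inter> S) = (\<Union>n. cmap c ` (X n \<inter> S))" by auto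
  ultimately show ?thesis by (simp add: suminf_indicator)
qed

lemma suminf_commute_ennreal:
  fixes f :: "nat \<Rightarrow> nat \<Rightarrow> ennreal"
  shows "(\<Sum>i. \<Sum>j. f i j) = (\<Sum>j. \<Sum>i. f i j)"
  by (subst (1 2) nn_integral_count_space_nat[symmetric])
    (simp add: nn_integral_suminf)

lemma differentiable_transition:
  assumes "smoothly_compatible c d" and "X \<subseteq> cdom c \<inter> cdom d"
  shows "transition c d differentiable_on cmap c ` X"
proof -
  have "Ck_on (Suc 0) (cmap c ` (cdom c \<inter> cdom d)) (transition c d)"
    using assms(1) by (simp add: smoothly_compatible_def smooth_on_def)
  then have "transition c d differentiable at x" if "x \<in> cmap c ` X" for x
    using that assms(2) by auto
  then show ?thesis
    by (intro differentiable_at_imp_differentiable_on) auto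
qed

section \<open>Densities and null sets on a foliated manifold\<close>

locale riemannian_foliation =
  fixes A B :: "('a::{t2_space, second_countable_topology}, 'n::finite) chart set"
    and g :: "('a, 'n) metric" and K :: "'n set"
  assumes manifold: "riemannian_manifold A g"
    and atlas: "foliated_atlas A K B"
begin

abbreviation "r \<equiv> chart_seq A"
abbreviation "s \<equiv> chart_seq B"

lemma is_chart: "c \<in> A \<Longrightarrow> is_chart c"
  and cover_A: "(\<Union>c\<in>A. cdom c) = UNIV"
  and compatible: "c \<in> A \<Longrightarrow> d \<in> A \<Longrightarrow> smoothly_compatible c d"
  using manifold by (auto simp: riemannian_manifold_def smooth_structure_def)

lemma B_subset: "B \<subseteq> A"
  and cover_B: "(\<Union>c\<in>B. cdom c) = UNIV"
  using atlas by (auto simp: foliated_atlas_def)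

lemma r: "r i \<in> A" "is_chart (r i)" "(\<Union>i. cdom (r i)) = UNIV"
proof -
  note q = chart_seq[OF is_chart cover_A]
  show "r i \<in> A" using q(1) by (simp add: image_subset_iff)
  then show "is_chart (r i)" by (rule is_chart)
qed (rule chart_seq(2)[OF is_chart cover_A])

lemma s: "s i \<in> B" "s i \<in> A" "is_chart (s i)" "(\<Union>i. cdom (s i)) = UNIV"
proof -
  have ch: "is_chart c" if "c \<in> B" for c using that B_subset is_chart by blast
  show "s i \<in> B" using chart_seq(1)[OF ch cover_B] by (simp add: image_subset_iff)
  then show "s i \<in> A" using B_subset by blast
  then show "is_chart (s i)" by (rule is_chart)
  show "(\<Union>i. cdom (s i)) = UNIV" by (rule chart_seq(2)[OF ch cover_B])
qed

text \<open>Cutting off outside the chart image yields a Borel function on the whole coordinate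
  space. \<open>J = UNIV\<close> gives the Riemannian volume, \<open>J = K\<close> the induced
  volume on plaques.\<close>

definition vol_density :: "'n set \<Rightarrow> ('a, 'n) chart \<Rightarrow> real ^ 'n \<Rightarrow> real" where
  "vol_density J c z = indicator (cimg c) z * sqrt (minor_det J (g c z))"

lemma vol_density_pos:
  assumes "c \<in> A" "z \<in> cimg c" shows "vol_density J c z > 0"
proof -
  have "minor_det J (g c z) > 0"
    using manifold assms
    by (intro minor_det_pos) (auto simp: riemannian_manifold_def riemannian_metric_def)
  then show ?thesis using assms by (simp add: vol_density_def)
qed

lemma vol_density_borel [measurable]:
  assumes "c \<in> A" shows "vol_density J c \<in> borel_measurable borel"
proof -
  have "Ck_on 0 (cimg c) (g c)"
    using manifold assms unfolding riemannian_manifold_def riemannian_metric_def smooth_on_def by blast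
  then have "continuous_on (cimg c) (g c)" by simp
  then have "continuous_on (cimg c) (\<lambda>z. sqrt (minor_det J (g c z)))"
    by (intro continuous_intros)
  from borel_measurable_continuous_on_indicator[OF _ this] show ?thesis
    using open_cimg[OF is_chart[OF assms]] by (simp add: vol_density_def[abs_def])
qed

lemma vol_density_mult_indicator:
  "T \<subseteq> cimg c \<Longrightarrow> ennreal (sqrt (minor_det J (g c z))) * indicator T z
    = ennreal (vol_density J c z) * indicator T z"
  by (auto simp: vol_density_def indicator_def)

text \<open>Being null in one chart implies being null in every chart, because changes of coordinates
  are differentiable; no change of variables formula is needed.\<close>

definition chart_null :: "'a set \<Rightarrow> bool" where
  "chart_null E \<longleftrightarrow> (\<forall>c\<in>A. negligible (cmap c ` (E \<inter> cdom c)))"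

lemma negligible_transfer:
  assumes "c \<in> A" "d \<in> A" "X \<subseteq> cdom c \<inter> cdom d" "negligible (cmap c ` X)"
  shows "negligible (cmap d ` X)"
proof -
  have "cmap d ` X = transition c d ` cmap c ` X"
    using assms(3) cinv_cmap[OF is_chart[OF assms(1)]]
    by (auto simp: transition_def image_image intro!: image_cong)
  then show ?thesis
    using negligible_differentiable_image_negligible[OF order_refl assms(4)
        differentiable_transition[OF compatible[OF assms(1,2)] assms(3)]] by simp
qed

lemma chart_null_UN:
  assumes "\<And>i::nat. chart_null (X i)" shows "chart_null (\<Union>i. X i)"
  unfolding chart_null_def
proof
  fix c assume "c \<in> A"
  then have "negligible (\<Union>i. cmap c ` (X i \<inter> cdom c))"
    using assms by (auto simp: chart_null_def intro!: negligible_countable_Union)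
  then show "negligible (cmap c ` ((\<Union>i. X i) \<inter> cdom c))"
    by (rule negligible_subset) auto
qed

lemma chart_null_subset: "chart_null X \<Longrightarrow> Y \<subseteq> X \<Longrightarrow> chart_null Y"
  unfolding chart_null_def by (blast intro: negligible_subset)

lemma chart_null_Un: "chart_null X \<Longrightarrow> chart_null Y \<Longrightarrow> chart_null (X \<union> Y)"
  unfolding chart_null_def by (simp add: Int_Un_distrib2 image_Un negligible_Un)

lemma chart_null_in_chart:
  assumes "d \<in> A" "X \<subseteq> cdom d" "negligible (cmap d ` X)" shows "chart_null X"
  unfolding chart_null_def
proof
  fix c assume "c \<in> A"
  have "negligible (cmap d ` (X \<inter> cdom c))"
    using assms(3) by (rule negligible_subset) auto
  then show "negligible (cmap c ` (X \<inter> cdom c))"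
    using assms \<open>c \<in> A\<close> by (intro negligible_transfer[of d c]) auto
qed

lemma chart_null_pieces:
  assumes "\<And>i. q i \<in> A" "(\<Union>i. cdom (q i)) = UNIV"
    and "\<And>i. negligible (cmap (q i) ` (E \<inter> piece q i))"
  shows "chart_null E"
proof -
  have "chart_null (\<Union>i. E \<inter> piece q i)"
  proof (intro chart_null_UN chart_null_in_chart)
    show "E \<inter> piece q i \<subseteq> cdom (q i)" for i using piece_subset[of q i] by blast
  qed (use assms in auto)
  moreover have "(\<Union>i. E \<inter> piece q i) = E" using UN_piece[of q] assms(2) by auto
  ultimately show ?thesis by simp
qed

section \<open>The Riemannian measure before completion\<close>

definition M :: "'a measure" where
  "M = measure_of UNIV (sets borel) (\<lambda>E. \<Sum>i. \<integral>\<^sup>+ x. ennreal (sqrt (det (g (r i) x))) *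
               indicator (cmap (r i) ` (E \<inter> piece r i)) x \<partial>lborel)"

lemma riem_measure_eq: "riem_measure A g = completion M"
  by (simp add: riem_measure_def M_def Let_def)

lemma sets_M [simp, measurable_cong]: "sets M = sets borel" and space_M [simp]: "space M = UNIV"
  using sets.sigma_sets_eq[of "borel :: 'a measure"] by (auto simp: M_def)

text \<open>\<open>measure_of\<close> returns the given set function only if that is countably
  additive; this follows by exchanging the two sums and the integral.\<close>

lemma emeasure_M:
  assumes "E \<in> sets borel"
  shows "emeasure M E = (\<Sum>i. \<integral>\<^sup>+ x. ennreal (vol_density UNIV (r i) x) *
               indicator (cmap (r i) ` (E \<inter> piece r i)) x \<partial>lborel)"
proof -
  let ?F = "\<lambda>E. \<Sum>i. \<integral>\<^sup>+ x. ennreal (vol_density UNIV (r i) x) *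
               indicator (cmap (r i) ` (E \<inter> piece r i)) x \<partial>lborel"
  have "ennreal (sqrt (det (g (r i) x))) * indicator (cmap (r i) ` (E \<inter> piece r i)) x
      = ennreal (vol_density UNIV (r i) x) * indicator (cmap (r i) ` (E \<inter> piece r i)) x" for E i x
    using vol_density_mult_indicator[of "cmap (r i) ` (E \<inter> piece r i)" "r i" UNIV] piece_subset[of r i]
    by (auto simp: minor_det_UNIV)
  then have "M = measure_of UNIV (sets borel) ?F" by (simp add: M_def)
  moreover have "countably_additive (sets borel) ?F"
  proof (rule countably_additiveI)
    fix X :: "nat \<Rightarrow> 'a set" assume X: "range X \<subseteq> sets borel" "disjoint_family X"
    have [measurable]: "vol_density UNIV (r i) \<in> borel_measurable borel" for i by (rule vol_density_borel[OF r(1)])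
    have [measurable]: "cmap (r i) ` (X n \<inter> piece r i) \<in> sets borel" for i n
      using X r by (intro cmap_piece_borel) auto
    have "(\<Sum>n. ?F (X n)) = (\<Sum>i. \<Sum>n. \<integral>\<^sup>+ x. ennreal (vol_density UNIV (r i) x) *
               indicator (cmap (r i) ` (X n \<inter> piece r i)) x \<partial>lborel)"
      by (rule suminf_commute_ennreal)
    also have "\<dots> = (\<Sum>i. \<integral>\<^sup>+ x. (\<Sum>n. ennreal (vol_density UNIV (r i) x) *
               indicator (cmap (r i) ` (X n \<inter> piece r i)) x) \<partial>lborel)"
      by (intro suminf_cong nn_integral_suminf[symmetric]) measurable
    also have "\<dots> = ?F (\<Union>n. X n)"
      using indicator_cmap_UN[OF r(2) piece_subset[of r] X(2)] by simp
    finally show "(\<Sum>n. ?F (X n)) = ?F (\<Union>n. X n)" .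
  qed
  ultimately show ?thesis
    using assms sets.sigma_algebra_axioms[of "borel :: 'a measure"]
    by (simp add: emeasure_measure_of_sigma positive_def)
qed

text \<open>The density is positive on chart images, so a summand vanishes iff the image of the
  piece is Lebesgue null. The criterion does not refer to the chosen charts
  \<open>r\<close>.\<close>

lemma null_sets_M_iff:
  assumes "E \<in> sets borel" shows "E \<in> null_sets M \<longleftrightarrow> chart_null E"
proof -
  have T [measurable]: "cmap (r i) ` (E \<inter> piece r i) \<in> sets borel" for i
    using assms r by (intro cmap_piece_borel) auto
  have [measurable]: "vol_density UNIV (r i) \<in> borel_measurable borel" for i by (rule vol_density_borel[OF r(1)])
  have *: "(\<integral>\<^sup>+ x. ennreal (vol_density UNIV (r i) x) * indicator (cmap (r i) ` (E \<inter> piece r i)) x \<partial>lborel) = 0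
      \<longleftrightarrow> negligible (cmap (r i) ` (E \<inter> piece r i))" for i
  proof -
    have "(\<integral>\<^sup>+ x. ennreal (vol_density UNIV (r i) x) * indicator (cmap (r i) ` (E \<inter> piece r i)) x \<partial>lborel) = 0
      \<longleftrightarrow> (AE x in lborel. ennreal (vol_density UNIV (r i) x) * indicator (cmap (r i) ` (E \<inter> piece r i)) x = 0)"
      by (rule nn_integral_0_iff_AE) measurable
    also have "\<dots> \<longleftrightarrow> (AE x in lborel. x \<notin> cmap (r i) ` (E \<inter> piece r i))"
      using vol_density_pos[OF r(1), of _ i UNIV] piece_subset[of r i]
      by (intro AE_cong) (fastforce simp: indicator_def ennreal_eq_0_iff not_le)
    also have "\<dots> \<longleftrightarrow> cmap (r i) ` (E \<inter> piece r i) \<in> null_sets lborel"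
      using T by (subst AE_iff_null_sets) auto
    also have "\<dots> \<longleftrightarrow> negligible (cmap (r i) ` (E \<inter> piece r i))"
      using T by (simp add: negligible_iff_null_sets null_sets_completion_iff)
    finally show ?thesis .
  qed
  have "E \<in> null_sets M \<longleftrightarrow> (\<forall>i. negligible (cmap (r i) ` (E \<inter> piece r i)))"
    using assms * by (simp add: null_sets_def emeasure_M suminf_eq_zero_iff)
  also have "\<dots> \<longleftrightarrow> chart_null E"
    using chart_null_pieces[of r E] r piece_subset[of r]
    by (auto simp: chart_null_def) (meson Int_mono image_mono negligible_subset order_refl r(1))
  finally show ?thesis .
qed

lemma sigma_finite_M: "sigma_finite_measure M"
proof
  \<comment> \<open>Bounding coordinates and density together bounds the measure of the
    corresponding set by \<open>m\<close> times the volume of a ball of radius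
    \<open>m\<close>.\<close>
  define T where "T i m = {z \<in> cimg (r i). norm z \<le> real m \<and> vol_density UNIV (r i) z \<le> real m}" for i and m :: nat
  have [measurable]: "vol_density UNIV (r i) \<in> borel_measurable borel" for i by (rule vol_density_borel[OF r(1)])
  have T [measurable]: "T i m \<in> sets borel" for i m
  proof -
    have "{z \<in> space borel. norm z \<le> real m \<and> vol_density UNIV (r i) z \<le> real m} \<in> sets borel" by measurable
    moreover have "cimg (r i) \<in> sets borel" using open_cimg[OF r(2)] by simp
    moreover have "T i m = cimg (r i) \<inter> {z \<in> space borel. norm z \<le> real m \<and> vol_density UNIV (r i) z \<le> real m}"
      by (auto simp: T_def)
    ultimately show ?thesis by auto
  qed
  define C where "C i m = piece r i \<inter> (cmap (r i) -` T i m \<inter> cdom (r i))" for i and m :: nat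
  have C: "C i m \<in> sets borel" for i m
    unfolding C_def using r T by (intro sets.Int piece_borel cmap_vimage_borel) auto
  have fin: "emeasure M (C i m) \<noteq> \<infinity>" for i m
  proof -
    have "emeasure M (C i m) = (\<integral>\<^sup>+ x. ennreal (vol_density UNIV (r i) x) *
               indicator (cmap (r i) ` (C i m \<inter> piece r i)) x \<partial>lborel)"
      (is "_ = ?I i")
    proof -
      \<comment> \<open>By disjointness of the pieces only the \<open>i\<close>-th summand of the
        measure survives.\<close>
      have "C i m \<inter> piece r j = {}" if "j \<noteq> i" for j
        using disjoint_piece[of j i r] that by (auto simp: C_def)
      then show ?thesis
        by (subst emeasure_M[OF C], subst suminf_finite[of "{i}"]) auto
    qed
    also have "\<dots> \<le> (\<integral>\<^sup>+ x. ennreal (real m) * indicator (cball (0 :: real ^ 'n) (real m)) x \<partial>lborel)"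
      by (intro nn_integral_mono) (auto simp: C_def T_def indicator_def intro!: ennreal_leI)
    also have "\<dots> = ennreal (real m) * emeasure lborel (cball (0 :: real ^ 'n) (real m))"
      by (subst nn_integral_cmult_indicator) auto
    also have "\<dots> < \<infinity>"
      using emeasure_lborel_cball_finite[of "0 :: real ^ 'n"] by (simp add: ennreal_mult_less_top)
    finally show ?thesis by simp
  qed
  have "(\<Union>i. \<Union>m. C i m) = UNIV"
  proof (intro set_eqI iffI UNIV_I)
    fix x :: 'a
    obtain i where i: "x \<in> piece r i" using UN_piece[of r] r(3) by auto
    obtain m :: nat where "max (norm (cmap (r i) x)) (vol_density UNIV (r i) (cmap (r i) x)) \<le> real m"
      using real_arch_simple by blast
    then have "x \<in> C i m" using i piece_subset[of r i] by (auto simp: C_def T_def)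
    then show "x \<in> (\<Union>i. \<Union>m. C i m)" by auto
  qed
  then show "\<exists>Y. countable Y \<and> Y \<subseteq> sets M \<and> \<Union>Y = space M \<and> (\<forall>a\<in>Y. emeasure M a \<noteq> \<infinity>)"
    using C fin by (intro exI[of _ "range (\<lambda>(i, m). C i m)"]) (auto simp: split_beta UN_iff set_eq_iff)
qed

end

section \<open>Plaques, leaves and null saturations\<close>

context riemannian_foliation
begin

definition plaque :: "('a, 'n) chart \<Rightarrow> 'a \<Rightarrow> 'a set" where
  "plaque c x = {y \<in> cdom c. \<forall>i. i \<notin> K \<longrightarrow> cmap c y $ i = cmap c x $ i}"

definition leaf :: "'a \<Rightarrow> 'a set" where
  "leaf x = (plaque_rel K B)\<^sup>* `` {x}"

lemma plaque_self: "x \<in> cdom c \<Longrightarrow> x \<in> plaque c x"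
  and plaque_sub: "y \<in> plaque c x \<Longrightarrow> y \<in> cdom c"
  and plaque_eq: "y \<in> plaque c x \<Longrightarrow> plaque c y = plaque c x"
  by (auto simp: plaque_def)

lemma plaque_sym: "x \<in> cdom c \<Longrightarrow> y \<in> plaque c x \<Longrightarrow> x \<in> plaque c y"
  using plaque_eq plaque_self by blast

lemma plaques_of_eq: "plaques_of K c = plaque c ` cdom c"
proof (intro set_eqI iffI)
  fix P assume "P \<in> plaques_of K c"
  then obtain t x where P: "P = {x \<in> cdom c. \<forall>i. i \<notin> K \<longrightarrow> cmap c x $ i = t i}" "x \<in> P"
    by (auto simp: plaques_of_def)
  then have "P = plaque c x" by (auto simp: plaque_def)
  then show "P \<in> plaque c ` cdom c" using P by auto
next
  fix P assume "P \<in> plaque c ` cdom c"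
  then obtain x where "x \<in> cdom c" "P = plaque c x" by auto
  then show "P \<in> plaques_of K c"
    unfolding plaques_of_def plaque_def
    by (auto intro!: exI[of _ "\<lambda>i. cmap c x $ i"])
qed

lemma plaque_rel_iff: "(x, y) \<in> plaque_rel K B \<longleftrightarrow> (\<exists>c\<in>B. x \<in> cdom c \<and> y \<in> plaque c x)"
proof -
  have "(\<exists>P \<in> plaques_of K c. x \<in> P \<and> y \<in> P) \<longleftrightarrow> x \<in> cdom c \<and> y \<in> plaque c x" for c
    unfolding plaques_of_eq by (auto simp: plaque_def)
  then show ?thesis by (simp add: plaque_rel_def)
qed

lemma plaque_Int_open:
  assumes "c \<in> B" "d \<in> B" "x \<in> cdom c" "y \<in> cdom d"
  obtains W where "open W" "plaque c x \<inter> plaque d y = plaque c x \<inter> W"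
proof -
  have "openin (top_of_set (plaque c x)) (plaque c x \<inter> plaque d y)"
    using atlas assms unfolding foliated_atlas_def plaques_of_eq by blast
  then show thesis using that by (auto simp: openin_open)
qed

text \<open>In coordinates a plaque is the intersection of a convex set with an affine subspace, and
  the inverse chart is continuous.\<close>

lemma connected_plaque:
  assumes "c \<in> B" shows "connected (plaque c x)"
proof -
  have ch: "is_chart c" using assms B_subset is_chart by blast
  let ?S = "cimg c \<inter> {z. \<forall>i. i \<notin> K \<longrightarrow> z $ i = cmap c x $ i}"
  have "convex (cimg c)"
    using atlas assms by (auto simp: foliated_atlas_def is_interval_convex)
  moreover have "convex {z :: real ^ 'n. \<forall>i. i \<notin> K \<longrightarrow> z $ i = cmap c x $ i}"
  proof (rule convexI)
    fix z w :: "real ^ 'n" and u v :: real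
    assume zw: "z \<in> {z. \<forall>i. i \<notin> K \<longrightarrow> z $ i = cmap c x $ i}" "w \<in> {z. \<forall>i. i \<notin> K \<longrightarrow> z $ i = cmap c x $ i}"
      and uv: "0 \<le> u" "0 \<le> v" "u + v = 1"
    have "u * a + v * a = a" for a :: real
      using uv by (simp flip: distrib_right)
    then show "u *\<^sub>R z + v *\<^sub>R w \<in> {z. \<forall>i. i \<notin> K \<longrightarrow> z $ i = cmap c x $ i}"
      using zw by simp
  qed
  ultimately have "connected ?S" by (intro convex_connected convex_Int)
  then have "connected (cinv c ` ?S)"
    by (intro connected_continuous_image continuous_on_subset[OF continuous_on_cinv[OF ch]]) auto
  moreover have "cinv c ` ?S = plaque c x"
  proof (intro set_eqI iffI)
    fix y assume "y \<in> cinv c ` ?S"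
    then show "y \<in> plaque c x"
      using cinv_in_cdom[OF ch] cmap_cinv[OF ch] by (auto simp: plaque_def)
  next
    fix y assume "y \<in> plaque c x"
    then have "y = cinv c (cmap c y)" "cmap c y \<in> ?S"
      using cinv_cmap[OF ch] by (auto simp: plaque_def)
    then show "y \<in> cinv c ` ?S" by blast
  qed
  ultimately show ?thesis by simp
qed

section \<open>Leaves by means of countably many charts\<close>

definition seq_rel :: "('a \<times> 'a) set" where
  "seq_rel = {(x, y). \<exists>i. x \<in> cdom (s i) \<and> y \<in> plaque (s i) x}"

lemma rtrancl_sym:
  assumes "sym R" "(x, y) \<in> R\<^sup>*" shows "(y, x) \<in> R\<^sup>*"
  using assms sym_rtrancl[of R] by (auto dest: symD)

lemma sym_plaque_rel: "sym (plaque_rel K B)" and sym_seq_rel: "sym seq_rel"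
  by (auto simp: sym_def plaque_rel_def) (auto simp: seq_rel_def intro: plaque_sym plaque_sub)

text \<open>Each point of a plaque of an arbitrary chart in \<open>B\<close> lies in some
  \<open>cdom (s i)\<close>, and by coherence the plaque of \<open>s i\<close> covers a relative
  neighbourhood of it. Classes of \<open>seq_rel\<^sup>*\<close> are thus relatively open in the
  plaque, and connectedness leaves only one.\<close>

lemma rtrancl_seq_rel: "(plaque_rel K B)\<^sup>* = seq_rel\<^sup>*"
proof
  have "seq_rel \<subseteq> plaque_rel K B"
    using s(1) by (force simp: seq_rel_def plaque_rel_iff)
  then show "seq_rel\<^sup>* \<subseteq> (plaque_rel K B)\<^sup>*" by (rule rtrancl_mono)
  have "(x, y) \<in> seq_rel\<^sup>*" if xy: "(x, y) \<in> plaque_rel K B" for x y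
  proof -
    obtain c where c: "c \<in> B" "x \<in> cdom c" "y \<in> plaque c x" using xy by (auto simp: plaque_rel_iff)
    show ?thesis
    proof (rule connected_equivalence_relation[OF connected_plaque[OF c(1)], of x x y "\<lambda>x y. (x, y) \<in> seq_rel\<^sup>*"])
      fix a assume a: "a \<in> plaque c x"
      have ac: "a \<in> cdom c" using a by (rule plaque_sub)
      have "a \<in> (\<Union>i. cdom (s i))" unfolding s(4) by simp
      then obtain i where i: "a \<in> cdom (s i)" by blast
      obtain W where W: "open W" "plaque c a \<inter> plaque (s i) a = plaque c a \<inter> W"
        by (rule plaque_Int_open[OF c(1) s(1) ac i])
      have "(a, z) \<in> seq_rel\<^sup>*" if "z \<in> plaque c a \<inter> W" for z
        using that i unfolding W(2)[symmetric] by (auto simp: seq_rel_def)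
      moreover have "a \<in> plaque c a \<inter> W"
        unfolding W(2)[symmetric] using i ac by (simp add: plaque_self)
      ultimately show "\<exists>T. openin (top_of_set (plaque c x)) T \<and> a \<in> T \<and> (\<forall>z\<in>T. (a, z) \<in> seq_rel\<^sup>*)"
        using W(1) unfolding plaque_eq[OF a] by (intro exI[of _ "plaque c x \<inter> W"]) (auto simp: openin_open)
    qed (fact plaque_self[OF c(2)] c(3) | erule (1) rtrancl_trans | erule rtrancl_sym[OF sym_seq_rel])+
  qed
  then show "(plaque_rel K B)\<^sup>* \<subseteq> seq_rel\<^sup>*"
    by (intro rtrancl_subset_rtrancl) auto
qed

lemma leaf_self: "x \<in> leaf x"
  by (simp add: leaf_def)

lemma leaf_eq: "y \<in> leaf x \<Longrightarrow> leaf y = leaf x"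
  unfolding leaf_def using rtrancl_sym[OF sym_plaque_rel] by (auto intro: rtrancl_trans)

lemma plaque_leaf: "x \<in> cdom (s i) \<Longrightarrow> y \<in> plaque (s i) x \<Longrightarrow> leaf y = leaf x"
  by (rule leaf_eq) (auto simp: leaf_def plaque_rel_iff intro!: r_into_rtrancl bexI[OF _ s(1)])

lemma leaves_eq: "leaves K B = range leaf"
  by (auto simp: leaves_def leaf_def quotient_def)

section \<open>Countably many Borel maps along leaves\<close>

definition dense_pts :: "nat \<Rightarrow> real ^ 'n" where
  "dense_pts = (SOME q. \<forall>X. open X \<longrightarrow> X \<noteq> {} \<longrightarrow> (\<exists>k. q k \<in> X))"

lemma dense_pts:
  assumes "open X" "X \<noteq> {}" shows "\<exists>k. dense_pts k \<in> X"
proof -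
  obtain D :: "(real ^ 'n) set" where D: "countable D" "\<And>X. open X \<Longrightarrow> X \<noteq> {} \<Longrightarrow> \<exists>d\<in>D. d \<in> X"
    using countable_dense_setE by blast
  have "D \<noteq> {}" using D(2)[of UNIV] by auto
  then have "range (from_nat_into D) = D" using D(1) by simp
  then have "\<forall>X. open X \<longrightarrow> X \<noteq> {} \<longrightarrow> (\<exists>k. from_nat_into D k \<in> X)"
    using D(2) by (metis rangeE)
  then have "\<forall>X. open X \<longrightarrow> X \<noteq> {} \<longrightarrow> (\<exists>k. dense_pts k \<in> X)"
    unfolding dense_pts_def by (rule someI[where P="\<lambda>q. \<forall>X. open X \<longrightarrow> X \<noteq> {} \<longrightarrow> (\<exists>k. q k \<in> X)"])
  then show ?thesis using assms by blast
qed

text \<open>Moving within a plaque to a point with leafwise coordinates from a fixed countable dense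
  set. Compositions of these countably many Borel maps visit every plaque of a leaf, since
  plaques that meet do so in a relatively open set; they replace holonomy maps.\<close>

definition move :: "nat \<Rightarrow> nat \<Rightarrow> 'a \<Rightarrow> 'a" where
  "move i k x = (let z = splice K (($) (dense_pts k)) (cmap (s i) x) in
     if x \<in> cdom (s i) \<and> z \<in> cimg (s i) then cinv (s i) z else x)"

lemma continuous_on_splice: "continuous_on S f \<Longrightarrow> continuous_on S (\<lambda>x. splice K y (f x))"
  and continuous_on_splice_left: "continuous_on T (\<lambda>y. splice K (($) y) t)"
  unfolding splice_def
  by (intro continuous_on_vec_lambda, rename_tac i, case_tac "i \<in> K"; auto intro!: continuous_intros)+

lemma move_borel [measurable]: "move i k \<in> borel_measurable borel"
proof -
  let ?z = "\<lambda>x. splice K (($) (dense_pts k)) (cmap (s i) x)"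
  let ?U = "cdom (s i) \<inter> ?z -` cimg (s i)"
  have z: "continuous_on (cdom (s i)) ?z"
    by (rule continuous_on_splice[OF continuous_on_cmap[OF s(3)]])
  have "open ?U"
    using continuous_open_preimage[OF z open_cdom[OF s(3)] open_cimg[OF s(3)]] .
  moreover have "continuous_on ?U (\<lambda>x. cinv (s i) (?z x))"
    by (rule continuous_on_compose2[OF continuous_on_cinv[OF s(3)] continuous_on_subset[OF z]]) auto
  ultimately have "(\<lambda>x. if x \<in> ?U then cinv (s i) (?z x) else x) \<in> borel_measurable borel"
    by (intro borel_measurable_continuous_on_if) (auto intro: continuous_on_id)
  also have "(\<lambda>x. if x \<in> ?U then cinv (s i) (?z x) else x) = move i k"
    by (auto simp: move_def Let_def fun_eq_iff)
  finally show ?thesis .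
qed

lemma move_plaque: "move i k x = x \<or> x \<in> cdom (s i) \<and> move i k x \<in> plaque (s i) x"
  using cinv_in_cdom[OF s(3)] cmap_cinv[OF s(3)]
  by (auto simp: move_def Let_def plaque_def splice_def)

text \<open>The leafwise coordinates that lead from \<open>x\<close> into \<open>W\<close> form a
  nonempty open set, the preimage of \<open>?V\<close> under \<open>?z\<close>, so one of the dense
  points belongs to it.\<close>

lemma move_hits:
  assumes x: "x \<in> cdom (s i)" and W: "open W" "plaque (s i) x \<inter> W \<noteq> {}"
  shows "\<exists>k. move i k x \<in> plaque (s i) x \<inter> W"
proof -
  let ?V = "cmap (s i) ` (W \<inter> cdom (s i))"
  let ?z = "\<lambda>y. splice K (($) y) (cmap (s i) x)"
  obtain y where y: "y \<in> plaque (s i) x" "y \<in> W" using W by auto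
  have "?z (cmap (s i) y) = cmap (s i) y"
    using y(1) by (auto simp: splice_def plaque_def vec_eq_iff)
  then have "cmap (s i) y \<in> ?z -` ?V" using y plaque_sub[OF y(1)] by auto
  moreover have "open (?z -` ?V)"
    by (intro open_vimage open_cmap_image s W continuous_on_splice_left)
  ultimately obtain k where k: "dense_pts k \<in> ?z -` ?V" using dense_pts by blast
  then obtain w where w: "w \<in> W" "w \<in> cdom (s i)" "?z (dense_pts k) = cmap (s i) w" by auto
  then have "move i k x = w"
    using x cinv_cmap[OF s(3)] by (simp add: move_def Let_def)
  moreover have "w \<in> plaque (s i) x"
    using w unfolding plaque_def by (auto simp: splice_def simp flip: w(3))
  ultimately show ?thesis using w by blast
qed

text \<open>The head of the list is the last move, so prepending a move prolongs the walk at its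
  end.\<close>

primrec walk :: "(nat \<times> nat) list \<Rightarrow> 'a \<Rightarrow> 'a" where
  "walk [] x = x"
| "walk (m # ms) x = move (fst m) (snd m) (walk ms x)"

lemma walk_borel [measurable]: "walk ms \<in> borel_measurable borel"
proof (induction ms)
  case (Cons m ms)
  from measurable_compose[OF Cons move_borel] show ?case by simp
qed (simp add: measurable_ident_sets)

lemma walk_leaf: "walk ms x \<in> leaf x"
proof (induction ms)
  case (Cons m ms)
  have "leaf (walk (m # ms) x) = leaf (walk ms x)"
    using move_plaque[of "fst m" "snd m" "walk ms x"] plaque_leaf by auto
  then show ?case using Cons leaf_eq leaf_self by blast
qed (simp add: leaf_self)

text \<open>Induction along a chain of plaques from \<open>x\<close> to \<open>y\<close>: the next
  plaque meets the current one in a relatively open set, and by \<open>move_hits\<close> one more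
  move lands there.\<close>

lemma walk_reaches:
  assumes "y \<in> leaf x" "y \<in> cdom (s i)"
  shows "\<exists>ms. walk ms x \<in> plaque (s i) y"
proof -
  have "(x, y) \<in> seq_rel\<^sup>*" using assms(1) by (simp add: leaf_def rtrancl_seq_rel)
  then show ?thesis using assms(2)
  \<comment> \<open>The index varies because the hypothesis for \<open>y\<close> is used in the
    chart \<open>s j\<close> that joins \<open>y\<close> to \<open>z\<close>.\<close>
  proof (induction arbitrary: i rule: rtrancl_induct)
    case base
    then show ?case by (intro exI[of _ "[]"]) (simp add: plaque_self)
  next
    case (step y z)
    then obtain j where j: "y \<in> cdom (s j)" "z \<in> plaque (s j) y" by (auto simp: seq_rel_def)
    obtain ms where ms: "walk ms x \<in> plaque (s j) y" using step.IH[OF j(1)] by auto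
    obtain W where W: "open W" "plaque (s j) y \<inter> plaque (s i) z = plaque (s j) y \<inter> W"
      using plaque_Int_open[OF s(1) s(1) j(1) step.prems] by metis
    have "z \<in> plaque (s j) y \<inter> W" unfolding W(2)[symmetric] using j step.prems plaque_self by auto
    then have "plaque (s j) (walk ms x) \<inter> W \<noteq> {}" using plaque_eq[OF ms] by auto
    moreover have "walk ms x \<in> cdom (s j)" using ms by (rule plaque_sub)
    ultimately obtain k where "move j k (walk ms x) \<in> plaque (s j) (walk ms x) \<inter> W"
      using move_hits W(1) by blast
    then have "walk ((j, k) # ms) x \<in> plaque (s i) z" using plaque_eq[OF ms] W(2) by auto
    then show ?case by blast
  qed
qed

section \<open>Saturations of leafwise open null sets\<close>

definition plaque_open :: "'a set \<Rightarrow> bool" where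
  "plaque_open D \<longleftrightarrow> (\<forall>j. \<forall>x \<in> D \<inter> cdom (s j). \<exists>W. open W \<and> x \<in> W \<and> W \<inter> plaque (s j) x \<subseteq> D)"

text \<open>\<open>plaque_open\<close> is openness in the leaf topology, tested in the charts
  \<open>s j\<close>. A union of plaques of one chart passes the test in every other chart by
  coherence.\<close>

lemma plaque_open_saturated:
  assumes "\<And>x. x \<in> X \<Longrightarrow> x \<in> cdom (s i) \<and> plaque (s i) x \<subseteq> X"
  shows "plaque_open X"
  unfolding plaque_open_def
proof (intro allI ballI)
  fix j x assume x: "x \<in> X \<inter> cdom (s j)"
  then have i: "x \<in> cdom (s i)" "plaque (s i) x \<subseteq> X" using assms by auto
  obtain W where W: "open W" "plaque (s j) x \<inter> plaque (s i) x = plaque (s j) x \<inter> W"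
    using plaque_Int_open[OF s(1) s(1), of x j x i] x i by auto
  have "x \<in> plaque (s j) x \<inter> W" unfolding W(2)[symmetric] using i x plaque_self by auto
  then show "\<exists>W. open W \<and> x \<in> W \<and> W \<inter> plaque (s j) x \<subseteq> X"
    using W i by (intro exI[of _ W]) auto
qed

lemma plaque_openD:
  assumes "plaque_open D" "x \<in> D" "x \<in> cdom (s j)"
  obtains W where "open W" "x \<in> W" "W \<inter> plaque (s j) x \<subseteq> D"
  using assms unfolding plaque_open_def by (metis IntI)

lemma plaque_open_Union:
  assumes "\<And>X. X \<in> \<X> \<Longrightarrow> plaque_open X" shows "plaque_open (\<Union>\<X>)"
  unfolding plaque_open_def
proof (intro allI ballI)
  fix j x assume "x \<in> \<Union>\<X> \<inter> cdom (s j)"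
  then obtain X where X: "X \<in> \<X>" "x \<in> X" "x \<in> cdom (s j)" by auto
  obtain W where "open W" "x \<in> W" "W \<inter> plaque (s j) x \<subseteq> X"
    using assms[OF X(1)] X(2,3) by (rule plaque_openD)
  then show "\<exists>W. open W \<and> x \<in> W \<and> W \<inter> plaque (s j) x \<subseteq> \<Union>\<X>"
    using X(1) by (intro exI[of _ W]) auto
qed

definition plaque_hull :: "nat \<Rightarrow> 'a set \<Rightarrow> 'a set" where
  "plaque_hull j D = {x \<in> cdom (s j). plaque (s j) x \<inter> D \<noteq> {}}"

lemma plaque_open_hull: "plaque_open (plaque_hull j D)"
proof (rule plaque_open_saturated)
  fix x assume x: "x \<in> plaque_hull j D"
  have "y \<in> plaque_hull j D" if "y \<in> plaque (s j) x" for y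
    using x plaque_eq[OF that] plaque_sub[OF that] by (simp add: plaque_hull_def)
  then show "x \<in> cdom (s j) \<and> plaque (s j) x \<subseteq> plaque_hull j D"
    using x by (auto simp: plaque_hull_def)
qed

text \<open>A plaque meeting \<open>D\<close> does so in a nonempty open subset, which has positive leafwise measure;
  by Fubini this happens only over a null set of transverse positions.\<close>

lemma chart_null_hull:
  assumes D: "chart_null D" "plaque_open D"
  shows "chart_null (plaque_hull j D)"
proof (rule chart_null_in_chart[OF s(2)[of j]])
  have "cmap (s j) ` (D \<inter> cdom (s j)) \<in> null_sets lebesgue"
    using D(1) s(2) by (auto simp: chart_null_def negligible_iff_null_sets)
  \<comment> \<open>\<open>D\<close> is an arbitrary set, so Fubini's theorem is applied to a Borel
    null set enclosing its image.\<close>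
  then obtain S where S: "S \<in> null_sets lborel" "cmap (s j) ` (D \<inter> cdom (s j)) \<subseteq> S"
    by (auto simp: null_sets_completion_iff2)
  then have S' [measurable]: "S \<in> sets borel" by auto
  have "AE t in lborel. slice_measure K S t = 0"
    using S null_sets_lborel_iff_slices[OF S'] by simp
  moreover have "{t \<in> space lborel. slice_measure K S t \<noteq> 0} \<in> sets lborel" by measurable
  ultimately have "{t. slice_measure K S t \<noteq> 0} \<in> null_sets lborel"
    by (subst (asm) AE_iff_null) auto
  then have "negligible {t. slice_measure K S t \<noteq> 0}"
    by (simp add: negligible_iff_null_sets null_sets_completionI)
  moreover have "cmap (s j) ` plaque_hull j D \<subseteq> {t. slice_measure K S t \<noteq> 0}"
  proof clarify
    fix x assume x: "x \<in> plaque_hull j D" and 0: "slice_measure K S (cmap (s j) x) = 0"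
    then obtain y where y: "y \<in> plaque (s j) x" "y \<in> D" by (auto simp: plaque_hull_def)
    have yd: "y \<in> cdom (s j)" using y(1) by (rule plaque_sub)
    then obtain W where W: "open W" "y \<in> W" "W \<inter> plaque (s j) y \<subseteq> D"
      using plaque_openD[OF D(2) y(2) yd] by blast
    let ?V = "cmap (s j) ` (W \<inter> cdom (s j))"
    have "splice K (($) (cmap (s j) y)) (cmap (s j) x) = cmap (s j) y"
      using y(1) by (auto simp: splice_def plaque_def vec_eq_iff)
    \<comment> \<open>Near \<open>y\<close> the plaque lies in \<open>D\<close>, so the slice of
      \<open>S\<close> through \<open>x\<close> contains that of the open set \<open>?V\<close>,
      which is nonempty.\<close>
    then have "slice_measure K ?V (cmap (s j) x) \<noteq> 0"
      using yd W by (intro slice_measure_open_pos[of _ _ "($) (cmap (s j) y)"] open_cmap_image s) auto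
    moreover have "slice_measure K ?V (cmap (s j) x) \<le> slice_measure K S (cmap (s j) x)"
    proof (rule slice_measure_mono)
      fix u assume "splice K u (cmap (s j) x) \<in> ?V"
      then obtain w where w: "w \<in> W" "w \<in> cdom (s j)" "splice K u (cmap (s j) x) = cmap (s j) w" by auto
      then have "w \<in> plaque (s j) x"
        unfolding plaque_def by (auto simp: splice_def simp flip: w(3))
      then have "w \<in> D" using W w plaque_eq[OF y(1)] by auto
      then show "splice K u (cmap (s j) x) \<in> S" using S w by auto
    qed
    ultimately show False using 0 by simp
  qed
  ultimately show "negligible (cmap (s j) ` plaque_hull j D)" by (rule negligible_subset)
qed (auto simp: plaque_hull_def)

text \<open>Adding all plaque hulls \<open>n\<close> times reaches every point joined to
  \<open>D\<close> by a chain of \<open>n\<close> plaques. Each stage stays null and open in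
  plaques, so the next hull is null again; countably many stages exhaust the saturation.\<close>

lemma chart_null_saturation:
  assumes D: "chart_null D" "plaque_open D"
  shows "chart_null {x. leaf x \<inter> D \<noteq> {}}"
proof -
  define H where "H = rec_nat D (\<lambda>_ E. E \<union> (\<Union>j. plaque_hull j E))"
  have H_simps: "H 0 = D" "H (Suc n) = H n \<union> (\<Union>j. plaque_hull j (H n))" for n
    by (auto simp: H_def)
  have "chart_null (H n) \<and> plaque_open (H n)" for n
  proof (induction n)
    case (Suc n)
    have "chart_null (H (Suc n))"
      unfolding H_simps using Suc by (intro chart_null_Un chart_null_UN chart_null_hull) auto
    moreover have "H (Suc n) = \<Union>(insert (H n) (range (\<lambda>j. plaque_hull j (H n))))"
      by (simp add: H_simps)
    then have "plaque_open (H (Suc n))"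
      using Suc plaque_open_hull by (simp only:) (rule plaque_open_Union, auto)
    ultimately show ?case by simp
  qed (simp add: H_simps D)

  then have "chart_null (\<Union>n. H n)" by (intro chart_null_UN) auto
  moreover have "{x. leaf x \<inter> D \<noteq> {}} \<subseteq> (\<Union>n. H n)"
  proof
    fix x assume "x \<in> {x. leaf x \<inter> D \<noteq> {}}"
    then obtain y where "y \<in> leaf x" "y \<in> D" by auto
    have "(y, x) \<in> seq_rel\<^sup>*"
      using \<open>y \<in> leaf x\<close> rtrancl_sym[OF sym_seq_rel] by (auto simp: leaf_def rtrancl_seq_rel)
    then show "x \<in> (\<Union>n. H n)"
    proof (induction rule: rtrancl_induct)
      case base
      then show ?case using \<open>y \<in> D\<close> H_simps(1) by blast
    next
      case (step z x)
      then obtain n i where n: "z \<in> H n" "z \<in> cdom (s i)" "x \<in> plaque (s i) z" by (auto simp: seq_rel_def)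
      then have "z \<in> plaque (s i) x" "x \<in> cdom (s i)" using plaque_sym plaque_sub by blast+
      then have "x \<in> plaque_hull i (H n)" using n by (auto simp: plaque_hull_def)
      then have "x \<in> H (Suc n)" by (auto simp: H_simps)
      then show ?case by blast
    qed
  qed
  ultimately show ?thesis by (rule chart_null_subset)
qed

end

section \<open>Leaf measures\<close>

text \<open>The points to be summed over are listed by \<open>u n x\<close> with possible
  repetitions. Counting each one at its first index, collected in \<open>N x\<close>, turns the
  integral into a series, and being a first index is a measurable condition on
  \<open>x\<close>.\<close>

lemma borel_measurable_nn_integral_count_image:
  fixes u :: "nat \<Rightarrow> 'a \<Rightarrow> 'b::{second_countable_topology, t2_space}"
  assumes [measurable]: "\<And>n. u n \<in> borel_measurable M" "\<And>n. D n \<in> sets M"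
    and [measurable]: "\<Phi> \<in> borel_measurable borel"
    and sub: "\<And>n x. x \<in> D n \<Longrightarrow> u n x \<in> T"
  shows "(\<lambda>x. \<integral>\<^sup>+ t. indicator {u n x | n. x \<in> D n} t * \<Phi> t \<partial>count_space T) \<in> borel_measurable M"
proof -
  define N where "N x = {n. x \<in> D n \<and> (\<forall>m<n. x \<in> D m \<longrightarrow> u m x \<noteq> u n x)}" for x
  have bij: "bij_betw (\<lambda>n. u n x) (N x) {u n x | n. x \<in> D n}" for x
    unfolding bij_betw_def
  proof
    show "inj_on (\<lambda>n. u n x) (N x)"
      by (rule inj_onI, rule ccontr) (auto simp: N_def neq_iff)
    have "u n x \<in> (\<lambda>n. u n x) ` N x" if "x \<in> D n" for n
      using that
    proof (induction n rule: less_induct)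
      case (less n)
      show ?case
      proof (cases "n \<in> N x")
        case False
        then obtain m where "m < n" "x \<in> D m" "u m x = u n x" using less.prems by (auto simp: N_def)
        then show ?thesis using less.IH[of m] by simp
      qed simp
    qed
    then show "(\<lambda>n. u n x) ` N x = {u n x | n. x \<in> D n}" by (auto simp: N_def)
  qed
  have "(\<integral>\<^sup>+ t. indicator {u n x | n. x \<in> D n} t * \<Phi> t \<partial>count_space T) =
      (\<Sum>n. indicator (N x) n * \<Phi> (u n x))" for x
  proof -
    have "(\<integral>\<^sup>+ t. indicator {u n x | n. x \<in> D n} t * \<Phi> t \<partial>count_space T)
        = (\<integral>\<^sup>+ t. \<Phi> t \<partial>count_space {u n x | n. x \<in> D n})"
      using sub by (subst (1 2) nn_integral_count_space_indicator)
        (auto intro!: nn_integral_cong simp: indicator_def)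
    also have "\<dots> = (\<integral>\<^sup>+ n. \<Phi> (u n x) \<partial>count_space (N x))"
      using bij by (rule nn_integral_bij_count_space[symmetric])
    also have "\<dots> = (\<integral>\<^sup>+ n. indicator (N x) n * \<Phi> (u n x) \<partial>count_space UNIV)"
      by (subst nn_integral_count_space_indicator) (auto simp: mult.commute)
    finally show ?thesis by (simp add: nn_integral_count_space_nat)
  qed
  moreover have "(\<lambda>x. \<Sum>n. indicator (N x) n * \<Phi> (u n x)) \<in> borel_measurable M"
  proof -
    have [measurable]: "(\<lambda>x. indicator (N x) n :: ennreal) \<in> borel_measurable M" for n
    proof -
      have "{x \<in> space M. x \<in> D n \<and> (\<forall>m\<in>{..<n}. x \<in> D m \<longrightarrow> u m x \<noteq> u n x)} \<in> sets M"
        by measurable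
      then have "indicator {x \<in> space M. x \<in> D n \<and> (\<forall>m\<in>{..<n}. x \<in> D m \<longrightarrow> u m x \<noteq> u n x)}
          \<in> borel_measurable M" (is "?I \<in> _") by (rule borel_measurable_indicator)
      moreover have "?I x = (indicator (N x) n :: ennreal)" if "x \<in> space M" for x
        using that by (auto simp: N_def indicator_def)
      ultimately show ?thesis by (subst measurable_cong[where g="?I"]) auto
    qed
    show ?thesis by measurable
  qed
  ultimately show ?thesis by simp
qed

context riemannian_foliation
begin

text \<open>The inner integral of \<open>leaf_measure\<close>, with the density replaced by its
  Borel cut-off, which agrees with it on the chart image.\<close>

definition plaque_mass :: "nat \<Rightarrow> 'a set \<Rightarrow> real ^ 'n \<Rightarrow> ennreal" where
  "plaque_mass i E t = (\<integral>\<^sup>+ y. ennreal (vol_density K (s i) (splice K y t)) *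
     indicator (cmap (s i) ` (E \<inter> piece s i)) (splice K y t) \<partial>(\<Pi>\<^sub>M i\<in>K. lborel))"

text \<open>For a leaf \<open>L\<close>, these vectors name the plaques of \<open>s i\<close> inside
  \<open>L\<close>; restricting them to \<open>transversal\<close> counts every such plaque
  once.\<close>

definition leaf_positions :: "nat \<Rightarrow> 'a set \<Rightarrow> (real ^ 'n) set" where
  "leaf_positions i L = {t. \<exists>y \<in> L \<inter> cdom (s i). \<forall>j. j \<notin> K \<longrightarrow> t $ j = cmap (s i) y $ j}"

abbreviation transversal :: "(real ^ 'n) set" where
  "transversal \<equiv> {t. \<forall>i\<in>K. t $ i = 0}"

lemma cmap_piece [measurable]:
  "E \<in> sets borel \<Longrightarrow> cmap (s i) ` (E \<inter> piece s i) \<in> sets borel"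
  by (intro cmap_piece_borel s)

lemma vol_density_s [measurable]: "vol_density J (s i) \<in> borel_measurable borel"
  by (rule vol_density_borel[OF s(2)])

text \<open>A plaque that meets a leaf is contained in it, so intersecting with the leaf keeps or
  discards whole plaques.\<close>

lemma indicator_leaf:
  "(indicator (cmap (s i) ` (E \<inter> leaf x \<inter> piece s i)) (splice K y t) :: ennreal) =
    indicator (leaf_positions i (leaf x)) t * indicator (cmap (s i) ` (E \<inter> piece s i)) (splice K y t)"
proof -
  have "splice K y t \<in> cmap (s i) ` (E \<inter> leaf x \<inter> piece s i) \<longleftrightarrow>
      t \<in> leaf_positions i (leaf x) \<and> splice K y t \<in> cmap (s i) ` (E \<inter> piece s i)" (is "?l \<longleftrightarrow> ?r")
  proof
    assume ?l
    then obtain z where z: "z \<in> E" "z \<in> leaf x" "z \<in> piece s i" "splice K y t = cmap (s i) z" by auto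
    then have "z \<in> cdom (s i)" using piece_subset[of s i] by blast
    moreover have "t $ j = cmap (s i) z $ j" if "j \<notin> K" for j
      using that by (auto simp: splice_def simp flip: z(4))
    ultimately have "t \<in> leaf_positions i (leaf x)" using z(2) unfolding leaf_positions_def by blast
    then show ?r using z by auto
  next
    assume ?r
    then obtain z w where z: "z \<in> E" "z \<in> piece s i" "splice K y t = cmap (s i) z"
      and w: "w \<in> leaf x" "w \<in> cdom (s i)" "\<And>j. j \<notin> K \<Longrightarrow> t $ j = cmap (s i) w $ j"
      by (auto simp: leaf_positions_def)
    have zd: "z \<in> cdom (s i)" using z piece_subset[of s i] by blast
    have "cmap (s i) z $ j = cmap (s i) w $ j" if "j \<notin> K" for j
      using w(3)[OF that] that by (auto simp: splice_def simp flip: z(3))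
    then have "z \<in> plaque (s i) w" using zd by (simp add: plaque_def)
    then have "leaf z = leaf x" using plaque_leaf w leaf_eq by metis
    then have "z \<in> leaf x" using leaf_self by blast
    then show ?l using z by auto
  qed
  then show ?thesis by (auto simp: indicator_def)
qed

lemma plaque_mass_leaf:
  assumes [measurable]: "E \<in> sets borel"
  shows "plaque_mass i (E \<inter> leaf x) t = indicator (leaf_positions i (leaf x)) t * plaque_mass i E t"
proof -
  have "plaque_mass i (E \<inter> leaf x) t = (\<integral>\<^sup>+ y. indicator (leaf_positions i (leaf x)) t *
     (ennreal (vol_density K (s i) (splice K y t)) *
     indicator (cmap (s i) ` (E \<inter> piece s i)) (splice K y t)) \<partial>(\<Pi>\<^sub>M i\<in>K. lborel))"
    unfolding plaque_mass_def indicator_leaf by (simp add: ac_simps)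
  also have "\<dots> = indicator (leaf_positions i (leaf x)) t * plaque_mass i E t"
    unfolding plaque_mass_def by (rule nn_integral_cmult) measurable
  finally show ?thesis .
qed

lemma plaque_mass_borel [measurable]:
  assumes [measurable]: "E \<in> sets borel"
  shows "plaque_mass i E \<in> borel_measurable borel"
  unfolding plaque_mass_def[abs_def]
  by (rule borel_measurable_slice_integral[where G="\<lambda>z. ennreal (vol_density K (s i) z) *
      indicator (cmap (s i) ` (E \<inter> piece s i)) z"]) measurable

lemma plaque_mass_cong:
  assumes "\<And>j. j \<notin> K \<Longrightarrow> t $ j = t' $ j" shows "plaque_mass i E t = plaque_mass i E t'"
proof -
  have "splice K y t = splice K y t'" for y using assms by (simp add: splice_def vec_eq_iff)
  then show ?thesis by (simp add: plaque_mass_def)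
qed

lemma plaque_mass_eq_0_iff:
  assumes [measurable]: "E \<in> sets borel"
  shows "plaque_mass i E t = 0 \<longleftrightarrow> slice_measure K (cmap (s i) ` (E \<inter> piece s i)) t = 0"
proof -
  let ?S = "cmap (s i) ` (E \<inter> piece s i)"
  have [measurable]: "?S \<in> sets borel" by measurable
  have "ennreal (vol_density K (s i) z) * indicator ?S z = 0 \<longleftrightarrow> (indicator ?S z :: ennreal) = 0" for z
    using vol_density_pos[OF s(2), of z i K] piece_subset[of s i]
    by (fastforce simp: indicator_def ennreal_eq_0_iff not_le)
  then show ?thesis
    unfolding plaque_mass_def slice_measure_def by (subst (1 2) nn_integral_0_iff_AE) auto
qed

definition leaf_base :: "'a set \<Rightarrow> 'a measure" where
  "leaf_base L = measure_of L (sets (restrict_space borel L))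
        (\<lambda>E. \<Sum>i. \<integral>\<^sup>+ t. (\<integral>\<^sup>+ y. ennreal (sqrt (minor_det K (g (s i) (splice K y t)))) *
                 indicator (cmap (s i) ` (E \<inter> piece s i)) (splice K y t)
               \<partial>(\<Pi>\<^sub>M i\<in>K. lborel)) \<partial>count_space {t. \<forall>i\<in>K. t $ i = 0})"

lemma leaf_measure_eq: "leaf_measure K B g L = completion (leaf_base L)"
  by (simp add: leaf_measure_def leaf_base_def Let_def)

lemma sets_leaf_base: "sets (leaf_base L) = sets (restrict_space borel L)"
  and space_leaf_base: "space (leaf_base L) = L"
proof -
  have sub: "sets (restrict_space borel L) \<subseteq> Pow L"
    using sets.space_closed[of "restrict_space borel L"] by (simp add: space_restrict_space)
  show "sets (leaf_base L) = sets (restrict_space borel L)"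
    using sets.sigma_sets_eq[of "restrict_space borel L"] sub
    by (simp add: leaf_base_def space_restrict_space)
  show "space (leaf_base L) = L"
    using sub by (simp add: leaf_base_def)
qed

text \<open>Countable additivity has to be checked before \<open>measure_of\<close> can be
  evaluated. The trace on the leaf then becomes a restriction of the transverse sum.\<close>

lemma emeasure_leaf_base:
  assumes "E \<in> sets borel"
  shows "emeasure (leaf_base (leaf x)) (E \<inter> leaf x) =
    (\<Sum>i. \<integral>\<^sup>+ t. indicator (leaf_positions i (leaf x)) t * plaque_mass i E t \<partial>count_space transversal)"
proof -
  let ?L = "leaf x"
  let ?F = "\<lambda>E. \<Sum>i. \<integral>\<^sup>+ t. plaque_mass i E t \<partial>count_space transversal"
  let ?S = "sets (restrict_space borel ?L)"
  have "ennreal (sqrt (minor_det K (g (s i) z))) * indicator (cmap (s i) ` (E \<inter> piece s i)) z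
      = ennreal (vol_density K (s i) z) * indicator (cmap (s i) ` (E \<inter> piece s i)) z" for E i z
    using piece_subset[of s i] by (intro vol_density_mult_indicator) auto
  then have "leaf_base ?L = measure_of ?L ?S ?F"
    by (simp add: leaf_base_def plaque_mass_def)
  moreover have "countably_additive ?S ?F"
  proof (rule countably_additiveI)
    fix X :: "nat \<Rightarrow> 'a set" assume X: "range X \<subseteq> ?S" "disjoint_family X"
    have "\<exists>E. E \<in> sets borel \<and> X n = E \<inter> ?L" for n
    proof -
      have "X n \<in> ?S" using X(1) by blast
      then show ?thesis by (auto simp: sets_restrict_space)
    qed
    then obtain Y where Y: "\<And>n. Y n \<in> sets borel" "\<And>n. X n = Y n \<inter> ?L" by metis
    \<comment> \<open>\<open>X n\<close> is only the trace of a Borel set \<open>Y n\<close> on the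
      leaf; for fixed \<open>t\<close> the trace contributes a constant factor, so the integrand is
      measurable.\<close>
    have m: "(\<lambda>y. ennreal (vol_density K (s i) (splice K y t)) *
        indicator (cmap (s i) ` (X n \<inter> piece s i)) (splice K y t)) \<in> borel_measurable (\<Pi>\<^sub>M i\<in>K. lborel)" for i n t
    proof -
      have [measurable]: "Y n \<in> sets borel" by (rule Y)
      show ?thesis unfolding Y(2) indicator_leaf by measurable
    qed
    have add: "plaque_mass i (\<Union>n. X n) t = (\<Sum>n. plaque_mass i (X n) t)" for i t
      unfolding plaque_mass_def indicator_cmap_UN[OF s(3) piece_subset[of s i] X(2)]
        ennreal_suminf_cmult[symmetric]
      by (rule nn_integral_suminf[OF m])
    show "(\<Sum>n. ?F (X n)) = ?F (\<Union>n. X n)"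
      unfolding add by (subst suminf_commute_ennreal) (simp add: nn_integral_suminf)
  qed
  moreover have "sigma_algebra ?L ?S"
    using sets.sigma_algebra_axioms[of "restrict_space borel ?L"] by (simp add: space_restrict_space)
  moreover have "positive ?S ?F"
    by (simp add: positive_def plaque_mass_def)
  moreover have "E \<inter> ?L \<in> ?S"
    using assms by (auto simp: sets_restrict_space)
  ultimately have "emeasure (leaf_base ?L) (E \<inter> ?L) = ?F (E \<inter> ?L)"
    by (simp add: emeasure_measure_of_sigma)
  then show ?thesis by (simp add: plaque_mass_leaf[OF assms])
qed

text \<open>The set of plaques summed over varies with \<open>x\<close>, but the walks list it: the
  transverse positions of the leaf through \<open>x\<close> are the values \<open>u i n x\<close>,
  each Borel in \<open>x\<close>.\<close>

lemma emeasure_leaf_base_measurable: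
  assumes [measurable]: "E \<in> sets borel"
  shows "(\<lambda>x. emeasure (leaf_base (leaf x)) (E \<inter> leaf x)) \<in> borel_measurable borel"
proof -
  \<comment> \<open>Lists of pairs of naturals are countable, so all walks are enumerated by
    \<open>n\<close>.\<close>
  define H where "H n = walk (from_nat n)" for n
  have [measurable]: "H n \<in> borel_measurable borel" for n unfolding H_def by (rule walk_borel)
  define D where "D i n = H n -` cdom (s i)" for i n
  have D [measurable]: "D i n \<in> sets borel" for i n
    using measurable_sets[of "H n" borel borel "cdom (s i)"] open_cdom[OF s(3)] by (simp add: D_def)
  \<comment> \<open>Setting the leafwise coordinates to 0 projects the endpoint of the walk to
    \<open>transversal\<close>; off \<open>D i n\<close> the value 0 merely makes the map
    total.\<close>
  define u where "u i n x = (if x \<in> D i n then splice K (\<lambda>_. 0) (cmap (s i) (H n x)) else 0)" for i n x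
  have u: "u i n \<in> borel_measurable borel" for i n
  proof -
    have "(\<lambda>z. if z \<in> cdom (s i) then splice K (\<lambda>_. 0) (cmap (s i) z) else 0) \<in> borel_measurable borel"
      using open_cdom[OF s(3)]
      by (intro borel_measurable_continuous_on_if continuous_on_splice continuous_on_cmap s) auto
    from measurable_compose[OF \<open>H n \<in> _\<close> this] show ?thesis
      by (simp add: u_def[abs_def] D_def)
  qed
  have pos: "t \<in> leaf_positions i (leaf x) \<longleftrightarrow> t \<in> {u i n x | n. x \<in> D i n}" (is "?l \<longleftrightarrow> ?r")
    if t: "t \<in> transversal" for t i x
  proof
    assume ?l
    then obtain y where y: "y \<in> leaf x" "y \<in> cdom (s i)" "\<And>j. j \<notin> K \<Longrightarrow> t $ j = cmap (s i) y $ j"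
      by (auto simp: leaf_positions_def)
    then obtain ms where ms: "walk ms x \<in> plaque (s i) y" using walk_reaches by blast
    define n where "n = to_nat ms"
    have n: "H n x \<in> plaque (s i) y" using ms by (simp add: H_def n_def)
    then have "x \<in> D i n" using plaque_sub[OF n] by (simp add: D_def)
    moreover have "t = u i n x"
      using n y(3) t calculation by (auto simp: u_def vec_eq_iff splice_def plaque_def)
    ultimately show ?r by blast
  next
    assume ?r
    then obtain n where n: "t = u i n x" "x \<in> D i n" by auto
    have "H n x \<in> leaf x \<inter> cdom (s i)" using n(2) walk_leaf by (auto simp: D_def H_def)
    moreover have "\<forall>j. j \<notin> K \<longrightarrow> t $ j = cmap (s i) (H n x) $ j"
      using n by (auto simp: u_def splice_def)
    ultimately show ?l unfolding leaf_positions_def by blast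
  qed
  have "(\<integral>\<^sup>+ t. indicator (leaf_positions i (leaf x)) t * plaque_mass i E t \<partial>count_space transversal) =
      (\<integral>\<^sup>+ t. indicator {u i n x | n. x \<in> D i n} t * plaque_mass i E t \<partial>count_space transversal)" for i x
    using pos by (intro nn_integral_cong) (simp add: indicator_def)
  moreover have "(\<lambda>x. \<integral>\<^sup>+ t. indicator {u i n x | n. x \<in> D i n} t * plaque_mass i E t \<partial>count_space transversal)
      \<in> borel_measurable borel" for i
    using u D plaque_mass_borel[OF assms]
    by (rule borel_measurable_nn_integral_count_image) (auto simp: u_def splice_def)
  ultimately show ?thesis
    by (simp add: emeasure_leaf_base)
qed

text \<open>A sum of nonnegative terms vanishes iff every term does. Since plaque masses see only
  transverse coordinates, positions can be replaced by points of the leaf.\<close>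

lemma emeasure_leaf_base_eq_0_iff:
  assumes "E \<in> sets borel"
  shows "emeasure (leaf_base (leaf x)) (E \<inter> leaf x) = 0 \<longleftrightarrow>
    (\<forall>i. \<forall>y \<in> leaf x \<inter> cdom (s i). plaque_mass i E (cmap (s i) y) = 0)"
proof -
  have "(\<integral>\<^sup>+ t. indicator (leaf_positions i (leaf x)) t * plaque_mass i E t \<partial>count_space transversal) = 0 \<longleftrightarrow>
    (\<forall>t \<in> transversal. t \<in> leaf_positions i (leaf x) \<longrightarrow> plaque_mass i E t = 0)" for i
    by (subst nn_integral_0_iff_AE) (auto simp: AE_count_space indicator_def)
  moreover have "(\<forall>t \<in> transversal. t \<in> leaf_positions i (leaf x) \<longrightarrow> plaque_mass i E t = 0) \<longleftrightarrow>
    (\<forall>y \<in> leaf x \<inter> cdom (s i). plaque_mass i E (cmap (s i) y) = 0)" (is "?l \<longleftrightarrow> ?r") for i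
  proof
    assume l: ?l
    show ?r
    proof
      fix y assume y: "y \<in> leaf x \<inter> cdom (s i)"
      let ?t = "splice K (\<lambda>_. 0) (cmap (s i) y)"
      have "?t \<in> leaf_positions i (leaf x)"
        unfolding leaf_positions_def using y by (auto simp: splice_def intro!: bexI[of _ y])
      moreover have "?t \<in> transversal" by (simp add: splice_def)
      ultimately have "plaque_mass i E ?t = 0" using l by blast
      moreover have "plaque_mass i E ?t = plaque_mass i E (cmap (s i) y)"
        by (rule plaque_mass_cong) (simp add: splice_def)
      ultimately show "plaque_mass i E (cmap (s i) y) = 0" by simp
    qed
  next
    assume r: ?r
    show ?l
    proof (intro ballI impI)
      fix t assume "t \<in> leaf_positions i (leaf x)"
      then obtain y where "y \<in> leaf x \<inter> cdom (s i)" "\<And>j. j \<notin> K \<Longrightarrow> t $ j = cmap (s i) y $ j"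
        unfolding leaf_positions_def by blast
      then show "plaque_mass i E t = 0" using r plaque_mass_cong[of t "cmap (s i) y" i E] by simp
    qed
  qed
  ultimately show ?thesis
    by (simp add: emeasure_leaf_base[OF assms] suminf_eq_zero_iff)
qed

text \<open>\<open>D i\<close> consists of the plaques of \<open>s i\<close> that charge the
  \<open>i\<close>-th piece of \<open>E\<close>. It is null by Fubini and a union of plaques, hence
  leafwise open, so the saturation of all \<open>D i\<close> is null; every leaf that charges
  \<open>E\<close> lies in that saturation.\<close>

lemma leaf_null_if_null:
  assumes E: "E \<in> sets borel" and null: "chart_null E"
  shows "chart_null {x. emeasure (leaf_base (leaf x)) (E \<inter> leaf x) \<noteq> 0}"
proof -
  define D where "D i = {y \<in> cdom (s i). plaque_mass i E (cmap (s i) y) \<noteq> 0}" for i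
  have "plaque_open (D i)" for i
  proof (rule plaque_open_saturated)
    fix x assume x: "x \<in> D i"
    have "y \<in> D i" if y: "y \<in> plaque (s i) x" for y
      using x y plaque_sub[OF y] plaque_mass_cong[of "cmap (s i) y" "cmap (s i) x" i E]
      by (simp add: D_def plaque_def)
    then show "x \<in> cdom (s i) \<and> plaque (s i) x \<subseteq> D i" using x by (auto simp: D_def)
  qed
  then have "plaque_open (\<Union>i. D i)" by (auto intro: plaque_open_Union)
  moreover have "chart_null (D i)" for i
  proof (rule chart_null_in_chart[OF s(2)[of i]])
    let ?S = "cmap (s i) ` (E \<inter> piece s i)"
    have S [measurable]: "?S \<in> sets borel" using E by measurable
    have "negligible ?S"
    proof (rule negligible_subset)
      show "negligible (cmap (s i) ` (E \<inter> cdom (s i)))" using null s(2) by (simp add: chart_null_def)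
    qed (use piece_subset[of s i] in auto)
    then have "?S \<in> null_sets lborel"
      using S by (simp add: negligible_iff_null_sets null_sets_completion_iff)
    then have "AE t in lborel. slice_measure K ?S t = 0"
      using null_sets_lborel_iff_slices[OF S] by simp
    then have "AE t in lborel. t \<notin> {t. plaque_mass i E t \<noteq> 0}"
      by eventually_elim (simp add: plaque_mass_eq_0_iff[OF E])
    then have "negligible {t. plaque_mass i E t \<noteq> 0}"
      by (subst (asm) AE_iff_null_sets[symmetric])
        (use plaque_mass_borel[OF E, of i] in \<open>auto simp: negligible_iff_null_sets null_sets_completionI\<close>)
    then show "negligible (cmap (s i) ` D i)"
      by (rule negligible_subset) (auto simp: D_def)
  qed (auto simp: D_def)
  then have "chart_null (\<Union>i. D i)" by (rule chart_null_UN)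
  ultimately have "chart_null {x. leaf x \<inter> (\<Union>i. D i) \<noteq> {}}"
    by (intro chart_null_saturation)
  then show ?thesis
    by (rule chart_null_subset) (auto simp: emeasure_leaf_base_eq_0_iff[OF E] D_def)
qed

text \<open>Fubini is used twice: the null set of leaves charging \<open>E\<close> has null slices
  for almost every \<open>t\<close>, which forces the slices of \<open>E\<close> to be null there,
  and then the pieces of \<open>E\<close> are null.\<close>

lemma null_if_leaf_null:
  assumes E: "E \<in> sets borel"
    and null: "chart_null {x. emeasure (leaf_base (leaf x)) (E \<inter> leaf x) \<noteq> 0}" (is "chart_null ?N")
  shows "chart_null E"
proof (rule chart_null_pieces[OF s(2) s(4)])
  fix i
  let ?S = "cmap (s i) ` (E \<inter> piece s i)"
  have S [measurable]: "?S \<in> sets borel" using E by measurable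
  \<comment> \<open>Coordinates of points whose plaque charges the \<open>i\<close>-th piece of
    \<open>E\<close>; these points lie on leaves of \<open>?N\<close>, and \<open>bad\<close>
    contains whole plaques.\<close>
  define bad where "bad = {t. plaque_mass i E t \<noteq> 0} \<inter> cimg (s i)"
  have "{t \<in> space borel. plaque_mass i E t \<noteq> 0} \<in> sets borel"
    using plaque_mass_borel[OF E, of i] by measurable
  then have bad: "bad \<in> sets borel" using open_cimg[OF s(3)] by (simp add: bad_def)
  have "bad \<subseteq> cmap (s i) ` (?N \<inter> cdom (s i))"
  proof
    fix t assume "t \<in> bad"
    then obtain y where "y \<in> cdom (s i)" "t = cmap (s i) y" "plaque_mass i E (cmap (s i) y) \<noteq> 0"
      by (auto simp: bad_def)
    then show "t \<in> cmap (s i) ` (?N \<inter> cdom (s i))"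
      using leaf_self by (auto simp: emeasure_leaf_base_eq_0_iff[OF E])
  qed
  then have "negligible bad"
    using null s(2) by (auto simp: chart_null_def intro: negligible_subset)
  then have "bad \<in> null_sets lborel"
    using bad by (simp add: negligible_iff_null_sets null_sets_completion_iff)
  then have "AE t in lborel. slice_measure K bad t = 0"
    using null_sets_lborel_iff_slices[OF bad] by simp
  then have "AE t in lborel. slice_measure K ?S t = 0"
  proof eventually_elim
    case (elim t)
    show ?case
    proof (rule ccontr)
      assume ne: "slice_measure K ?S t \<noteq> 0"
      then have mass: "plaque_mass i E t \<noteq> 0" by (simp add: plaque_mass_eq_0_iff[OF E])
      \<comment> \<open>A slice of nonzero measure is nonempty, so the slice of the open chart image
        over \<open>t\<close> is nonempty and has positive measure; it lies entirely in
        \<open>bad\<close>, whose slice over \<open>t\<close> is null.\<close>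
      obtain y where "splice K y t \<in> ?S"
        using ne by (force simp: slice_measure_def indicator_def)
      then have "splice K y t \<in> cimg (s i)" using piece_subset[of s i] by auto
      then have "slice_measure K (cimg (s i)) t \<noteq> 0"
        by (rule slice_measure_open_pos[OF open_cimg[OF s(3)]])
      moreover have "slice_measure K (cimg (s i)) t \<le> slice_measure K bad t"
      proof (rule slice_measure_mono)
        fix u assume "splice K u t \<in> cimg (s i)"
        moreover have "plaque_mass i E (splice K u t) = plaque_mass i E t"
          by (rule plaque_mass_cong) (simp add: splice_def)
        ultimately show "splice K u t \<in> bad" using mass by (simp add: bad_def)
      qed
      ultimately show False using elim by simp
    qed
  qed
  then have "?S \<in> null_sets lborel" using null_sets_lborel_iff_slices[OF S] by simp
  then show "negligible ?S" by (simp add: negligible_iff_null_sets null_sets_completionI)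
qed

section \<open>The foliation as a leaf system\<close>

sublocale leaf_system M leaf "leaf_measure K B g"
proof
  show "\<exists>Y. countable Y \<and> Y \<subseteq> sets M \<and> \<Union>Y = space M \<and> (\<forall>a\<in>Y. emeasure M a \<noteq> \<infinity>)"
    using sigma_finite_M by (rule sigma_finite_measure.sigma_finite_countable)
  fix x y :: 'a and E :: "'a set"
  show "x \<in> leaf x" by (rule leaf_self)
  show "y \<in> leaf x \<Longrightarrow> leaf y = leaf x" by (rule leaf_eq)
  show "space M = UNIV" by simp
  show "space (leaf_measure K B g (leaf x)) = leaf x"
    by (simp add: leaf_measure_eq space_leaf_base)
  have *: "E \<inter> leaf x \<in> sets (leaf_base (leaf x))" if "E \<in> sets M" for E x
    using that by (auto simp: sets_leaf_base sets_restrict_space)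
  show "E \<in> sets M \<Longrightarrow> E \<inter> leaf x \<in> sets (leaf_measure K B g (leaf x))"
    using * by (simp add: leaf_measure_eq)
  assume E: "E \<in> sets M"
  have eq: "(\<lambda>x. emeasure (leaf_measure K B g (leaf x)) (E \<inter> leaf x)) =
      (\<lambda>x. emeasure (leaf_base (leaf x)) (E \<inter> leaf x))"
    using *[OF E] by (simp add: leaf_measure_eq fun_eq_iff)
  show m: "(\<lambda>x. emeasure (leaf_measure K B g (leaf x)) (E \<inter> leaf x)) \<in> borel_measurable M"
    unfolding eq using emeasure_leaf_base_measurable E by simp
  have "{x \<in> space M. emeasure (leaf_measure K B g (leaf x)) (E \<inter> leaf x) \<noteq> 0} \<in> sets M"
    using m by measurable
  then have N: "{x. emeasure (leaf_base (leaf x)) (E \<inter> leaf x) \<noteq> 0} \<in> sets borel"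
    using fun_cong[OF eq] by simp
  show "E \<in> null_sets M \<longleftrightarrow>
      {x. emeasure (leaf_measure K B g (leaf x)) (E \<inter> leaf x) \<noteq> 0} \<in> null_sets M"
  proof -
    have E': "E \<in> sets borel" using E by simp
    show ?thesis
      unfolding fun_cong[OF eq] null_sets_M_iff[OF N] null_sets_M_iff[OF E']
      using leaf_null_if_null[OF E'] null_if_leaf_null[OF E'] by (rule iffI)
  qed
qed

end

theorem proposition3p5:
  fixes A B :: "('a::{t2_space, second_countable_topology}, 'n::finite) chart set"
    and g :: "('a, 'n) metric"
    and K :: "'n set"
    and p :: real
    and f\<^sub>0 :: "'a \<Rightarrow> real"
  assumes "riemannian_manifold A g"
    and "foliated_atlas A K B"
    and "p > 1"
    and "extremal (riem_measure A g) (leaves K B) (leaf_measure K B g) p f\<^sub>0"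
  shows "almost_every_leaf (riem_measure A g) (leaves K B)
           (\<lambda>L. (\<integral>\<^sup>+ x. ennreal (f\<^sub>0 x) \<partial>leaf_measure K B g L) = 1) \<and>
         (AE x in riem_measure A g. f\<^sub>0 x > 0)"
proof -
  interpret riemannian_foliation A B g K using assms(1,2) by unfold_locales
  show ?thesis
    using extremal_leaf_integral_pos[OF assms(3) assms(4)[unfolded riem_measure_eq leaves_eq]]
    unfolding riem_measure_eq leaves_eq by (rule conjI)
qed

end
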